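(* Assume that $K:L^2(\mathbb{T}^d)\to H^t(\mathbb{T}^d)$, where $t>d/2$, is (bounded, linear and) a Hilbert--Schmidt operator in $L^2(\mathbb{T}^d)$, and let $R(u)=\frac12\|u\|_{L^2(\mathbb{T}^d)}^2$. When the true unknown $u^\dagger$ fulfills the exact source condition $\mu^\dagger=K^*w^\dagger$ with $w^\dagger\in L^2(\mathbb{T}^d)$, where $\mu^\dagger=u^\dagger\in\partial R(u^\dagger)$, then with the choice $\alpha\simeq\delta^{2/3}$ we obtain the convergence rate $$E_B(U_\alpha^\delta,u^\dagger)=\mathbb{E}\,\|U_\alpha^\delta-u^\dagger\|_{L^2(\mathbb{T}^d)}^2\lesssim\delta^{2/3}.$$
   Context: $X=Y=L^2(\mathbb{T}^d)$ on the $d$-dimensional torus. $N$ is Gaussian white noise on $\mathbb{T}^d$: a centered Gaussian random variable in $\mathcal{D}'(\mathbb{T}^d)$ on a complete probability space with $\mathbb{E}\langle N,\phi\rangle\langle N,\psi\rangle=\langle\phi,\psi\rangle$ for all $\phi,\psi\in C^\infty(\mathbb{T}^d)$; its realizations lie almost surely in $H^{-d/2-\epsilon}(\mathbb{T}^d)$ for every $\epsilon>0$. The data are $F^\delta=Ku^\dagger+\delta N$, $\delta>0$, with deterministic $u^\dagger$. The estimator $U_\alpha^\delta$ is, realization-wise, the minimizer over $u\in L^2(\mathbb{T}^d)$ of $$\tfrac12\|Ku\|_{L^2}^2-\langle Ku,F^\delta\rangle_{H^t\times H^{-t}}+\alpha R(u).$$ $K^*$ is the adjoint of $K$ (with respect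 to $L^2$, extended to $H^{-t}(\mathbb{T}^d)\to L^2(\mathbb{T}^d)$). The risk is $E_B(U_\alpha^\delta,u^\dagger)=\mathbb{E}\,D_R^{\mu_\alpha^\delta,\mu^\dagger}(U_\alpha^\delta,u^\dagger)$, where $D_R^{\mu_u,\mu_v}(u,v)=\langle\mu_u-\mu_v,u-v\rangle$ is the symmetric Bregman distance, here equal to $\|u-v\|_{L^2}^2$. $a\simeq b$ means mutual boundedness by constant multiples and $a\lesssim b$ means $a\le Cb$, with constants independent of $\delta$, as $\delta\to0$. *)

theory Defs
  imports "HOL-Probability.Probability"
begin

text \<open>
  The torus is R^d / Z^d with d = CARD('d).  Functions on it are represented by functions on
  real^'d, restricted to the half-open unit cube where only the values almost everywhere matter.
  The total mass is 1, so the exponentials exp (2 pi i k.x), k in Z^d, are orthonormal.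
\<close>

definition torus_measure :: "(real^'d::finite) measure" where
  "torus_measure = restrict_space lborel {x. \<forall>i. 0 \<le> x $ i \<and> x $ i < 1}"

definition square_integrable_fun :: "(real^'d::finite \<Rightarrow> real) \<Rightarrow> bool" where
  "square_integrable_fun f \<longleftrightarrow>
     f \<in> borel_measurable torus_measure \<and> integrable torus_measure (\<lambda>x. (f x)\<^sup>2)"

lemma square_integrable_mult:
  fixes f g :: "real^'d::finite \<Rightarrow> real"
  assumes "square_integrable_fun f" "square_integrable_fun g"
  shows "integrable torus_measure (\<lambda>x. f x * g x)"
proof (rule Bochner_Integration.integrable_bound)
  show "integrable torus_measure (\<lambda>x. (f x)\<^sup>2 + (g x)\<^sup>2)"
    using assms by (auto simp: square_integrable_fun_def)
  show "(\<lambda>x. f x * g x) \<in> borel_measurable torus_measure"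
    using assms by (auto simp: square_integrable_fun_def)
  have "\<bar>a * b\<bar> \<le> a\<^sup>2 + b\<^sup>2" for a b :: real
    using sum_squares_bound[of "\<bar>a\<bar>" "\<bar>b\<bar>"] mult_nonneg_nonneg[of "\<bar>a\<bar>" "\<bar>b\<bar>"]
    unfolding abs_mult power2_abs by linarith
  then show "AE x in torus_measure. norm (f x * g x) \<le> norm ((f x)\<^sup>2 + (g x)\<^sup>2)"
    by simp
qed

lemma square_integrable_0: "square_integrable_fun (\<lambda>x. 0)"
  by (simp add: square_integrable_fun_def)

lemma square_integrable_scale:
  "square_integrable_fun f \<Longrightarrow> square_integrable_fun (\<lambda>x. c * f x)"
  by (auto simp: square_integrable_fun_def power_mult_distrib)

lemma square_integrable_add:
  assumes "square_integrable_fun f" "square_integrable_fun g"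
  shows "square_integrable_fun (\<lambda>x. f x + g x)"
  using assms square_integrable_mult[OF assms]
  by (auto simp: square_integrable_fun_def power2_sum mult.assoc)

lemma square_integrable_diff:
  assumes "square_integrable_fun f" "square_integrable_fun g"
  shows "square_integrable_fun (\<lambda>x. f x - g x)"
  using square_integrable_add[OF assms(1) square_integrable_scale[OF assms(2), of "-1"]] by simp

lemma square_integrable_uminus:
  "square_integrable_fun f \<Longrightarrow> square_integrable_fun (\<lambda>x. - f x)"
  using square_integrable_scale[of f "-1"] by simp

definition L2_rel :: "(real^'d::finite \<Rightarrow> real) \<Rightarrow> (real^'d \<Rightarrow> real) \<Rightarrow> bool" where
  "L2_rel f g \<longleftrightarrow> square_integrable_fun f \<and> square_integrable_fun g \<and>
     (AE x in torus_measure. f x = g x)"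

quotient_type 'd L2 = "real^'d::finite \<Rightarrow> real" / partial: L2_rel
proof (rule part_equivpI)
  show "\<exists>f. L2_rel f f"
    by (rule exI[of _ "\<lambda>x. 0"]) (simp add: L2_rel_def square_integrable_0)
  show "symp L2_rel"
    by (auto simp: symp_def L2_rel_def)
  show "transp L2_rel"
    by (auto simp: transp_def L2_rel_def elim: AE_mp)
qed

instantiation L2 :: (finite) real_vector
begin

lift_definition zero_L2 :: "'a L2" is "\<lambda>x. 0"
  by (simp add: L2_rel_def square_integrable_0)

lift_definition plus_L2 :: "'a L2 \<Rightarrow> 'a L2 \<Rightarrow> 'a L2" is "\<lambda>f g x. f x + g x"
  by (auto simp: L2_rel_def square_integrable_add)

lift_definition minus_L2 :: "'a L2 \<Rightarrow> 'a L2 \<Rightarrow> 'a L2" is "\<lambda>f g x. f x - g x"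
  by (auto simp: L2_rel_def square_integrable_diff)

lift_definition uminus_L2 :: "'a L2 \<Rightarrow> 'a L2" is "\<lambda>f x. - f x"
  by (auto simp: L2_rel_def square_integrable_uminus)

lift_definition scaleR_L2 :: "real \<Rightarrow> 'a L2 \<Rightarrow> 'a L2" is "\<lambda>c f x. c * f x"
  by (auto simp: L2_rel_def square_integrable_scale)

instance
proof
  fix u v w :: "'a L2" and a b :: real
  show "u + v + w = u + (v + w)"
    by transfer (auto simp: L2_rel_def square_integrable_add add.assoc)
  show "u + v = v + u"
    by transfer (auto simp: L2_rel_def square_integrable_add add.commute)
  show "0 + u = u"
    by transfer (auto simp: L2_rel_def)
  show "- u + u = 0"
    by transfer (auto simp: L2_rel_def square_integrable_0)
  show "u - v = u + - v"
    by transfer (auto simp: L2_rel_def square_integrable_diff)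
  show "a *\<^sub>R (u + v) = a *\<^sub>R u + a *\<^sub>R v"
    by transfer (auto simp: L2_rel_def square_integrable_add square_integrable_scale distrib_left)
  show "(a + b) *\<^sub>R u = a *\<^sub>R u + b *\<^sub>R u"
    by transfer (auto simp: L2_rel_def square_integrable_add square_integrable_scale distrib_right)
  show "a *\<^sub>R b *\<^sub>R u = (a * b) *\<^sub>R u"
    by transfer (auto simp: L2_rel_def square_integrable_scale mult.assoc)
  show "1 *\<^sub>R u = u"
    by transfer (auto simp: L2_rel_def)
qed

end

instantiation L2 :: (finite) real_inner
begin

lift_definition inner_L2 :: "'a L2 \<Rightarrow> 'a L2 \<Rightarrow> real" is
  "\<lambda>f g. \<integral>x. f x * g x \<partial>torus_measure"
  by (rule integral_cong_AE) (auto simp: L2_rel_def square_integrable_fun_def)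

definition norm_L2 :: "'a L2 \<Rightarrow> real" where
  "norm_L2 u = sqrt (inner u u)"

definition dist_L2 :: "'a L2 \<Rightarrow> 'a L2 \<Rightarrow> real" where
  "dist_L2 u v = norm (u - v)"

definition sgn_L2 :: "'a L2 \<Rightarrow> 'a L2" where
  "sgn_L2 u = u /\<^sub>R norm u"

definition uniformity_L2 :: "('a L2 \<times> 'a L2) filter" where
  "uniformity_L2 = (INF e\<in>{0<..}. principal {(u, v). dist u v < e})"

definition open_L2 :: "'a L2 set \<Rightarrow> bool" where
  "open_L2 S \<longleftrightarrow> (\<forall>u\<in>S. \<forall>\<^sub>F (u', v) in uniformity. u' = u \<longrightarrow> v \<in> S)"

instance
proof
  fix u v w :: "'a L2" and a :: real and S :: "'a L2 set"
  show "dist u v = norm (u - v)"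
    by (simp add: dist_L2_def)
  show "sgn u = u /\<^sub>R norm u"
    by (simp add: sgn_L2_def)
  show "uniformity = (INF e\<in>{0<..}. principal {(u, v::'a L2). dist u v < e})"
    by (simp add: uniformity_L2_def)
  show "open S \<longleftrightarrow> (\<forall>u\<in>S. \<forall>\<^sub>F (u', v) in uniformity. u' = u \<longrightarrow> v \<in> S)"
    by (simp add: open_L2_def)
  show "inner u v = inner v u"
    by transfer (simp add: mult.commute)
  show "inner (u + v) w = inner u w + inner v w"
    by transfer (simp add: L2_rel_def distrib_right square_integrable_mult)
  show "inner (a *\<^sub>R u) v = a * inner u v"
    by transfer (simp add: mult.assoc)
  show "0 \<le> inner u u"
    by transfer simp
  show "inner u u = 0 \<longleftrightarrow> u = 0"
  proof (transfer)
    fix f :: "real^'a \<Rightarrow> real"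
    assume "L2_rel f f"
    then have f: "square_integrable_fun f"
      by (simp add: L2_rel_def)
    have "(\<integral>x. f x * f x \<partial>torus_measure) = 0 \<longleftrightarrow> (AE x in torus_measure. f x * f x = 0)"
      by (rule integral_nonneg_eq_0_iff_AE[OF square_integrable_mult[OF f f]]) simp
    then show "(\<integral>x. f x * f x \<partial>torus_measure) = 0 \<longleftrightarrow> L2_rel f (\<lambda>x. 0)"
      using f by (simp add: L2_rel_def square_integrable_0)
  qed
  show "norm u = sqrt (inner u u)"
    by (simp add: norm_L2_def)
qed

end

definition partial_deriv :: "'d::finite \<Rightarrow> (real^'d \<Rightarrow> real) \<Rightarrow> real^'d \<Rightarrow> real" where
  "partial_deriv i f x = deriv (\<lambda>s. f (x + s *\<^sub>R axis i 1)) 0"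

text \<open>A multi-index is written as the list of the directions of differentiation.\<close>

definition iter_deriv :: "'d::finite list \<Rightarrow> (real^'d \<Rightarrow> real) \<Rightarrow> real^'d \<Rightarrow> real" where
  "iter_deriv is f = fold partial_deriv is f"

definition test_functions :: "(real^'d::finite \<Rightarrow> real) set" where
  "test_functions = {\<phi>.
     (\<forall>x i. \<phi> (x + axis i 1) = \<phi> x) \<and>
     (\<forall>is. continuous_on UNIV (iter_deriv is \<phi>) \<and>
        (\<forall>i x. (\<lambda>s. iter_deriv is \<phi> (x + s *\<^sub>R axis i 1)) differentiable (at 0)))}"

type_synonym 'd functional = "(real^'d \<Rightarrow> real) \<Rightarrow> real"

text \<open>
  Distributions are the linear functionals on the test functions that are continuous for the
  topology of uniform convergence of all derivatives; the last condition is continuity in terms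
  of the defining seminorms.  Values outside of the test functions are irrelevant.
\<close>

definition distributions :: "'d::finite functional set" where
  "distributions = {F.
     (\<forall>\<phi>\<in>test_functions. \<forall>\<psi>\<in>test_functions. F (\<lambda>x. \<phi> x + \<psi> x) = F \<phi> + F \<psi>) \<and>
     (\<forall>\<phi>\<in>test_functions. \<forall>c. F (\<lambda>x. c * \<phi> x) = c * F \<phi>) \<and>
     (\<exists>C m. \<forall>\<phi>\<in>test_functions. \<forall>B.
        (\<forall>is x. length is \<le> m \<longrightarrow> \<bar>iter_deriv is \<phi> x\<bar> \<le> B) \<longrightarrow> \<bar>F \<phi>\<bar> \<le> C * B)}"

lemma test_functions_measurable:
  "\<phi> \<in> test_functions \<Longrightarrow> \<phi> \<in> borel_measurable torus_measure"
  unfolding torus_measure_def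
  by (intro measurable_restrict_space1)
    (auto simp: test_functions_def iter_deriv_def intro!: borel_measurable_continuous_onI
      dest: spec[of _ "[]"])

lift_definition L2_dist :: "'d::finite L2 \<Rightarrow> 'd functional" is
  "\<lambda>f \<phi>. if \<phi> \<in> test_functions then \<integral>x. f x * \<phi> x \<partial>torus_measure else 0"
proof (rule ext)
  fix f g \<phi> :: "real^'d \<Rightarrow> real"
  assume fg: "L2_rel f g"
  have "(\<integral>x. f x * \<phi> x \<partial>torus_measure) = (\<integral>x. g x * \<phi> x \<partial>torus_measure)" if "\<phi> \<in> test_functions"
    using fg test_functions_measurable[OF that]
    by (intro integral_cong_AE) (auto simp: L2_rel_def square_integrable_fun_def)
  then show "(if \<phi> \<in> test_functions then \<integral>x. f x * \<phi> x \<partial>torus_measure else 0) =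
      (if \<phi> \<in> test_functions then \<integral>x. g x * \<phi> x \<partial>torus_measure else 0)"
    by simp
qed

definition freq :: "int^'d::finite \<Rightarrow> real^'d" where
  "freq k = (\<chi> i. of_int (k $ i))"

text \<open>The coefficient F(exp(-2 pi i k.x)), with F extended complex linearly.\<close>

definition fourier_coeff :: "'d::finite functional \<Rightarrow> int^'d \<Rightarrow> complex" where
  "fourier_coeff F k =
     Complex (F (\<lambda>x. cos (2 * pi * (freq k \<bullet> x)))) (- F (\<lambda>x. sin (2 * pi * (freq k \<bullet> x))))"

text \<open>Membership in H^s for any real s, via Fourier coefficients; the weight 1 + |k|^2 in
  place of 1 + |2 pi k|^2 gives an equivalent norm.\<close>

definition sobolev :: "real \<Rightarrow> 'd::finite functional set" where
  "sobolev s = {F\<in>distributions.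
     (\<lambda>k. (1 + (norm (freq k))\<^sup>2) powr s * (cmod (fourier_coeff F k))\<^sup>2) summable_on UNIV}"

definition sobolev_norm :: "real \<Rightarrow> 'd::finite functional \<Rightarrow> real" where
  "sobolev_norm s F =
     sqrt (\<Sum>\<^sub>\<infinity>k. (1 + (norm (freq k))\<^sup>2) powr s * (cmod (fourier_coeff F k))\<^sup>2)"

text \<open>
  The duality pairing of H^s and H^{-s}; the series converges absolutely for all elements of
  these spaces and does not depend on s.
\<close>

definition sobolev_pairing :: "'d::finite functional \<Rightarrow> 'd functional \<Rightarrow> real" where
  "sobolev_pairing G F = (\<Sum>\<^sub>\<infinity>k. Re (fourier_coeff G k * cnj (fourier_coeff F k)))"

definition bounded_linear_into_sobolev :: "real \<Rightarrow> ('d::finite L2 \<Rightarrow> 'd L2) \<Rightarrow> bool" where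
  "bounded_linear_into_sobolev s K \<longleftrightarrow> linear K \<and>
     (\<exists>C. \<forall>u. L2_dist (K u) \<in> sobolev s \<and> sobolev_norm s (L2_dist (K u)) \<le> C * norm u)"

definition orthonormal_basis :: "'a::real_inner set \<Rightarrow> bool" where
  "orthonormal_basis B \<longleftrightarrow>
     pairwise orthogonal B \<and> (\<forall>e\<in>B. norm e = 1) \<and> closure (span B) = UNIV"

definition hilbert_schmidt :: "('a::real_inner \<Rightarrow> 'b::real_inner) \<Rightarrow> bool" where
  "hilbert_schmidt T \<longleftrightarrow> bounded_linear T \<and>
     (\<exists>B. orthonormal_basis B \<and> (\<lambda>e. (norm (T e))\<^sup>2) summable_on B)"

text \<open>
  This determines \<open>T'\<close>: it is the Hilbert space adjoint (compare \<open>adjoint_unique\<close>).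
\<close>

definition is_adjoint :: "('a::real_inner \<Rightarrow> 'b::real_inner) \<Rightarrow> ('b \<Rightarrow> 'a) \<Rightarrow> bool" where
  "is_adjoint T T' \<longleftrightarrow> (\<forall>u v. T u \<bullet> v = u \<bullet> T' v)"

text \<open>The degenerate case of variance 0 counts as Gaussian.\<close>

definition centered_gaussian :: "'w measure \<Rightarrow> ('w \<Rightarrow> real) \<Rightarrow> bool" where
  "centered_gaussian M X \<longleftrightarrow> X \<in> borel_measurable M \<and>
     ((AE \<omega> in M. X \<omega> = 0) \<or> (\<exists>\<sigma>>0. distributed M lborel X (\<lambda>x. ennreal (normal_density 0 \<sigma> x))))"

definition white_noise :: "'w measure \<Rightarrow> ('w \<Rightarrow> 'd::finite functional) \<Rightarrow> bool" where
  "white_noise M N \<longleftrightarrow>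
     (\<forall>\<omega>\<in>space M. N \<omega> \<in> distributions) \<and>
     (\<forall>\<phi>\<in>test_functions. centered_gaussian M (\<lambda>\<omega>. N \<omega> \<phi>)) \<and>
     (\<forall>\<phi>\<in>test_functions. \<forall>\<psi>\<in>test_functions.
        (\<integral>\<omega>. N \<omega> \<phi> * N \<omega> \<psi> \<partial>M) = (\<integral>x. \<phi> x * \<psi> x \<partial>torus_measure))"

definition noisy_data ::
    "('d::finite L2 \<Rightarrow> 'd L2) \<Rightarrow> 'd L2 \<Rightarrow> ('w \<Rightarrow> 'd functional) \<Rightarrow> real \<Rightarrow> 'w \<Rightarrow> 'd functional" where
  "noisy_data K u0 N \<delta> \<omega> = (\<lambda>\<phi>. L2_dist (K u0) \<phi> + \<delta> * N \<omega> \<phi>)"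

definition tikhonov_functional ::
    "('d::finite L2 \<Rightarrow> 'd L2) \<Rightarrow> ('d L2 \<Rightarrow> real) \<Rightarrow> real \<Rightarrow> 'd functional \<Rightarrow> 'd L2 \<Rightarrow> real" where
  "tikhonov_functional K R a F u =
     (norm (K u))\<^sup>2 / 2 - sobolev_pairing (L2_dist (K u)) F + a * R u"

text \<open>The dual of the Hilbert space is identified with the space itself.\<close>

definition subdifferential :: "('a::real_inner \<Rightarrow> real) \<Rightarrow> 'a \<Rightarrow> 'a set" where
  "subdifferential R u = {\<mu>. \<forall>v. R u + \<mu> \<bullet> (v - u) \<le> R v}"

definition sym_bregman :: "'a::real_inner \<Rightarrow> 'a \<Rightarrow> 'a \<Rightarrow> 'a \<Rightarrow> real" where
  "sym_bregman \<mu> \<nu> u v = (\<mu> - \<nu>) \<bullet> (u - v)"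

definition bregman_risk ::
    "'w measure \<Rightarrow> ('w \<Rightarrow> 'a::real_inner) \<Rightarrow> 'a \<Rightarrow> ('w \<Rightarrow> 'a) \<Rightarrow> 'a \<Rightarrow> real" where
  "bregman_risk M \<mu> \<mu>0 U u0 = (\<integral>\<omega>. sym_bregman (\<mu> \<omega>) \<mu>0 (U \<omega>) u0 \<partial>M)"

end

theory Submission
  imports Defs
begin

text \<open>
  For almost every realisation the estimator minimises a quadratic functional on \<open>L\<^sup>2\<close>, and the
  rate comes from its first-order condition.  Write \<open>e = U - u0\<close>, and let \<open>\<langle>v, N\<rangle>\<close> stand for the
  duality pairing of \<open>v\<close> with the noise.  Testing the condition with \<open>e\<close> itself and using the source
  condition \<open>u0 = K\<^sup>* w0\<close> gives
  \<open>|K e|\<^sup>2 + \<alpha> |e|\<^sup>2 = \<delta> \<langle>K e, N\<rangle> - \<alpha> \<langle>K e, w0\<rangle>\<close>.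
  As \<open>K\<close> is bounded into \<open>H\<^sup>t\<close>, the noise term is at most \<open>\<delta> C |e| |N|\<close> with the norm of \<open>N\<close> taken
  in \<open>H\<^sup>-\<^sup>t\<close>.  Young's inequality absorbs \<open>K e\<close> and \<open>e\<close> into the left-hand side and leaves
  \<open>|e|\<^sup>2 \<le> \<delta>\<^sup>2 C\<^sup>2 |N|\<^sup>2 / \<alpha>\<^sup>2 + \<alpha> |w0|\<^sup>2 / 2\<close> (\<open>quad_tikhonov_error_bound\<close>).
  Each Fourier coefficient of \<open>N\<close> has second moment 1, so the expectation of \<open>|N|\<^sup>2\<close> is the lattice sum
  of \<open>(1 + |k|\<^sup>2)\<^sup>-\<^sup>t\<close>, which is finite because \<open>t > d/2\<close> (\<open>white_noise_sobolev_bound\<close>).  With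
  \<open>\<alpha>\<close> of the order \<open>\<delta>\<^sup>2\<^sup>/\<^sup>3\<close> both terms of the bound are of the order \<open>\<delta>\<^sup>2\<^sup>/\<^sup>3\<close>.

  Two points need an argument beyond this computation.  The data enter through a pairing of Fourier
  coefficients, and only Parseval's identity shows that the pairing of \<open>K u\<close> with \<open>K u0\<close> is the inner
  product of \<open>L\<^sup>2\<close>; it rests on the density of the trigonometric polynomials, which follows
  from the Stone--Weierstrass theorem and inner regularity (\<open>trig_closure_UNIV\<close>, \<open>parseval\<close>).
  And the estimator is only given realisation by realisation, so the measurability of its error
  has to be proved: minimisers are limits of near-minimisers selected from a countable dense set
  (\<open>borel_measurable_at_minimiser\<close>, \<open>L2_separable\<close>).
\<close>

section \<open>Lattice sums\<close>

lemma summable_on_int_inverse_powr: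
  assumes "s > 1 / 2"
  shows "(\<lambda>j::int. (1 + (real_of_int j)\<^sup>2) powr (- s)) summable_on UNIV"
proof -
  let ?f = "\<lambda>j::int. (1 + (real_of_int j)\<^sup>2) powr (- s)"
  have "summable (\<lambda>n::nat. norm (?f (int n)))"
  proof (rule summable_comparison_test')
    show "summable (\<lambda>n. real n powr (- (2 * s)))"
      using assms by (simp add: summable_real_powr_iff)
    fix n :: nat assume "n \<ge> 1"
    have "(1 + (real n)\<^sup>2) powr (- s) \<le> ((real n)\<^sup>2) powr (- s)"
      using \<open>n \<ge> 1\<close> assms by (intro powr_mono2') auto
    also have "\<dots> = real n powr (- (2 * s))"
      using \<open>n \<ge> 1\<close> powr_powr[of "real n" 2 "- s"] by (simp add: powr_numeral)
    finally show "norm (norm (?f (int n))) \<le> real n powr (- (2 * s))" by simp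
  qed
  then have nat: "(\<lambda>n. ?f (int n)) summable_on UNIV"
    by (rule norm_summable_imp_summable_on)
  have "?f summable_on range int"
    using nat by (subst summable_on_reindex) (auto simp: o_def inj_on_def)
  moreover have "?f summable_on range (\<lambda>n. - int n)"
    using nat by (subst summable_on_reindex) (auto simp: o_def inj_on_def)
  ultimately have "?f summable_on (range int \<union> range (\<lambda>n. - int n))"
    by (rule summable_on_union)
  moreover have "range int \<union> range (\<lambda>n. - int n) = UNIV"
    by (auto intro: int_cases2)
  ultimately show ?thesis by simp
qed

text \<open>
  Each coordinate satisfies \<open>k\<^sub>i\<^sup>2 \<le> |k|\<^sup>2\<close>, so the weight is at most a product of one-dimensional
  weights with exponent \<open>t/d > 1/2\<close>, and the sum over a box factorises.
\<close>

lemma summable_on_sobolev_weight: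
  assumes "t > real CARD('d) / 2"
  shows "(\<lambda>k::int^'d::finite. (1 + (norm (freq k))\<^sup>2) powr (- t)) summable_on UNIV"
proof -
  define s where "s = t / CARD('d)"
  have s: "s > 1 / 2" "t = s * CARD('d)"
    using assms by (auto simp: s_def field_simps)
  define f where "f j = (1 + (real_of_int j)\<^sup>2) powr (- s)" for j :: int
  have f: "f summable_on UNIV"
    unfolding f_def by (rule summable_on_int_inverse_powr[OF s(1)])
  have f0: "f j \<ge> 0" for j by (simp add: f_def)
  have le: "(1 + (norm (freq k))\<^sup>2) powr (- t) \<le> (\<Prod>i\<in>UNIV. f (k $ i))" for k :: "int^'d"
  proof -
    have "(1 + (norm (freq k))\<^sup>2) powr (- t) = (\<Prod>i\<in>(UNIV::'d set). (1 + (norm (freq k))\<^sup>2) powr (- s))"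
      unfolding s(2) prod_constant
      by (subst powr_power) (auto simp: mult.commute add_nonneg_eq_0_iff)
    also have "\<dots> \<le> (\<Prod>i\<in>UNIV. f (k $ i))"
    proof (intro prod_mono conjI)
      fix i
      have "\<bar>freq k $ i\<bar> \<le> norm (freq k)" by (rule component_le_norm_cart)
      then have "(real_of_int (k $ i))\<^sup>2 \<le> (norm (freq k))\<^sup>2"
        by (metis abs_le_square_iff abs_norm_cancel freq_def vec_lambda_beta)
      then show "(1 + (norm (freq k))\<^sup>2) powr (- s) \<le> f (k $ i)"
        unfolding f_def using s(1) by (intro powr_mono2') (auto simp: add_pos_nonneg)
    qed simp
    finally show ?thesis .
  qed
  have "(\<lambda>k::int^'d. \<Prod>i\<in>UNIV. f (k $ i)) summable_on UNIV"
  proof (rule nonneg_bdd_above_summable_on)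
    show "bdd_above (sum (\<lambda>k::int^'d. \<Prod>i\<in>UNIV. f (k $ i)) ` {F. F \<subseteq> UNIV \<and> finite F})"
    proof (rule bdd_aboveI2)
      fix F :: "(int^'d) set" assume "F \<in> {F. F \<subseteq> UNIV \<and> finite F}"
      then have F: "finite F" by simp
      define J where "J = (\<Union>k\<in>F. range (vec_nth k))"
      have J: "finite J" using F by (auto simp: J_def)
      have "(\<Sum>k\<in>F. \<Prod>i\<in>UNIV. f (k $ i)) = (\<Sum>g\<in>vec_nth ` F. \<Prod>i\<in>UNIV. f (g i))"
        by (subst sum.reindex) (auto simp: inj_on_def vec_nth_inject)
      also have "\<dots> \<le> (\<Sum>g\<in>PiE (UNIV::'d set) (\<lambda>_. J). \<Prod>i\<in>UNIV. f (g i))"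
      proof (rule sum_mono2)
        show "finite (PiE (UNIV::'d set) (\<lambda>_. J))" using J by (intro finite_PiE) auto
        show "vec_nth ` F \<subseteq> PiE UNIV (\<lambda>_. J)" by (auto simp: J_def)
      qed (use f0 in \<open>auto intro: prod_nonneg\<close>)
      also have "\<dots> = (\<Prod>i\<in>(UNIV::'d set). \<Sum>j\<in>J. f j)"
        using J by (subst prod_sum_PiE) auto
      also have "\<dots> \<le> (\<Prod>i\<in>(UNIV::'d set). infsum f UNIV)"
        using J f f0 by (intro prod_mono conjI finite_sum_le_infsum sum_nonneg) auto
      finally show "(\<Sum>k\<in>F. \<Prod>i\<in>UNIV. f (k $ i)) \<le> (\<Prod>i\<in>(UNIV::'d set). infsum f UNIV)" .
    qed
  qed (use f0 in \<open>auto intro: prod_nonneg\<close>)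
  then show ?thesis
    by (rule summable_on_comparison_test) (use le in auto)
qed

section \<open>Quadratic Tikhonov functionals\<close>

definition quad_tikhonov :: "('a::real_inner \<Rightarrow> 'b::real_inner) \<Rightarrow> real \<Rightarrow> ('a \<Rightarrow> real) \<Rightarrow> 'a \<Rightarrow> real" where
  "quad_tikhonov K a L u = (norm (K u))\<^sup>2 / 2 - L u + a * ((norm u)\<^sup>2 / 2)"

text \<open>
  The exact second-order expansion of the functional: the coefficient of \<open>s\<close> is the directional derivative
  and yields the first-order condition, the coefficient of \<open>s\<^sup>2\<close> yields quadratic growth away from
  a minimiser.
\<close>

lemma quad_tikhonov_add_scaleR:
  assumes "linear K" "linear L"
  shows "quad_tikhonov K a L (u + s *\<^sub>R v) = quad_tikhonov K a L u + s * (K u \<bullet> K v + a * (u \<bullet> v) - L v)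
    + s\<^sup>2 * (((norm (K v))\<^sup>2 + a * (norm v)\<^sup>2) / 2)"
  unfolding quad_tikhonov_def power2_norm_eq_inner
  by (simp add: linear_add[OF assms(1)] linear_scale[OF assms(1)] linear_add[OF assms(2)]
      linear_scale[OF assms(2)] inner_add_left inner_add_right inner_commute algebra_simps power2_eq_square
      add_divide_distrib)

lemma linear_coeff_zero_of_quadratic_nonneg:
  fixes p q :: real
  assumes "\<And>s. 0 \<le> s * p + s\<^sup>2 * q"
  shows "p = 0"
proof (rule ccontr)
  assume "p \<noteq> 0"
  \<comment> \<open>At s = - p / c the linear term beats the quadratic one as soon as c > q.\<close>
  define c where "c = \<bar>q\<bar> + 1"
  have c: "c > 0" "q < c" by (auto simp: c_def)
  have "0 \<le> (- p / c) * p + (- p / c)\<^sup>2 * q" by (rule assms)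
  also have "\<dots> = (p\<^sup>2 / c\<^sup>2) * (q - c)"
    using c by (simp add: field_simps power2_eq_square)
  also have "\<dots> < 0"
    using c \<open>p \<noteq> 0\<close> by (intro mult_pos_neg) auto
  finally show False by simp
qed

lemma quad_tikhonov_first_order:
  assumes "linear K" "linear L" and min: "\<And>v. quad_tikhonov K a L u \<le> quad_tikhonov K a L v"
  shows "K u \<bullet> K v + a * (u \<bullet> v) = L v"
proof -
  have "K u \<bullet> K v + a * (u \<bullet> v) - L v = 0"
  proof (rule linear_coeff_zero_of_quadratic_nonneg)
    fix s show "0 \<le> s * (K u \<bullet> K v + a * (u \<bullet> v) - L v) + s\<^sup>2 * (((norm (K v))\<^sup>2 + a * (norm v)\<^sup>2) / 2)"
      using min[of "u + s *\<^sub>R v"] quad_tikhonov_add_scaleR[OF assms(1,2), of a u s v] by linarith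
  qed
  then show ?thesis by simp
qed

lemma quad_tikhonov_quadratic_growth:
  assumes "linear K" "linear L" and min: "\<And>v. quad_tikhonov K a L u \<le> quad_tikhonov K a L v"
  shows "quad_tikhonov K a L u + a / 2 * (dist v u)\<^sup>2 \<le> quad_tikhonov K a L v"
proof -
  have "quad_tikhonov K a L (u + 1 *\<^sub>R (v - u)) = quad_tikhonov K a L u + ((norm (K (v - u)))\<^sup>2 + a * (norm (v - u))\<^sup>2) / 2"
    by (subst quad_tikhonov_add_scaleR[OF assms(1,2)]) (simp add: quad_tikhonov_first_order[OF assms])
  then show ?thesis by (simp add: dist_norm)
qed

text \<open>
  The first-order condition is tested with the error itself.  The source condition moves the
  regularisation bias behind \<open>K\<close>, where \<open>|K e|\<^sup>2\<close> absorbs it at the cost of \<open>a\<^sup>2 |w0|\<^sup>2 / 4\<close>; half of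
  \<open>a |e|\<^sup>2\<close> absorbs the noise functional \<open>l\<close>.
\<close>

lemma quad_tikhonov_error_bound:
  assumes K: "linear K" and l: "linear l" and a: "a > 0"
    and min: "\<And>v. quad_tikhonov K a (\<lambda>v. K v \<bullet> K u0 + l v) u \<le> quad_tikhonov K a (\<lambda>v. K v \<bullet> K u0 + l v) v"
    and bound: "\<And>v. \<bar>l v\<bar> \<le> c * norm v"
    and source: "\<And>v. v \<bullet> u0 = K v \<bullet> w0"
  shows "(norm (u - u0))\<^sup>2 \<le> c\<^sup>2 / a\<^sup>2 + a * (norm w0)\<^sup>2 / 2"
proof -
  define e where "e = u - u0"
  have lin: "linear (\<lambda>v. K v \<bullet> K u0 + l v)"
    using K l by (intro linearI) (auto simp: linear_add linear_scale inner_add_left algebra_simps)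
  have "K u \<bullet> K e + a * (u \<bullet> e) = K e \<bullet> K u0 + l e"
    by (rule quad_tikhonov_first_order[OF K lin min])
  moreover have "K u = K e + K u0" "u = e + u0"
    using K by (auto simp: e_def linear_diff)
  ultimately have "(norm (K e))\<^sup>2 + a * (norm e)\<^sup>2 = l e - a * (K e \<bullet> w0)"
    using source[of e]
    by (simp add: power2_norm_eq_inner inner_add_left inner_commute algebra_simps)
  moreover have "l e \<le> c\<^sup>2 / (2 * a) + a / 2 * (norm e)\<^sup>2"
  proof -
    have "0 \<le> (c - a * norm e)\<^sup>2 / (2 * a)" using a by simp
    also have "\<dots> = c\<^sup>2 / (2 * a) + a / 2 * (norm e)\<^sup>2 - c * norm e"
      using a by (simp add: field_simps power2_eq_square)
    finally show ?thesis using bound[of e] by linarith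
  qed
  moreover have "- a * (K e \<bullet> w0) \<le> (norm (K e))\<^sup>2 + a\<^sup>2 * (norm w0)\<^sup>2 / 4"
  proof -
    have "0 \<le> (norm (K e + (a / 2) *\<^sub>R w0))\<^sup>2" by simp
    also have "\<dots> = (norm (K e))\<^sup>2 + a\<^sup>2 * (norm w0)\<^sup>2 / 4 + a * (K e \<bullet> w0)"
      unfolding power2_norm_eq_inner
      by (simp add: inner_add_left inner_add_right inner_commute power2_eq_square algebra_simps)
    finally show ?thesis by linarith
  qed
  ultimately have "a / 2 * (norm e)\<^sup>2 \<le> c\<^sup>2 / (2 * a) + a\<^sup>2 * (norm w0)\<^sup>2 / 4"
    by linarith
  then have "2 / a * (a / 2 * (norm e)\<^sup>2) \<le> 2 / a * (c\<^sup>2 / (2 * a) + a\<^sup>2 * (norm w0)\<^sup>2 / 4)"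
    using a by (intro mult_left_mono) auto
  also have "\<dots> = c\<^sup>2 / a\<^sup>2 + a * (norm w0)\<^sup>2 / 2"
    using a by (simp add: field_simps power2_eq_square)
  finally show ?thesis using a by (simp add: e_def)
qed

lemma quad_tikhonov_continuous:
  assumes "bounded_linear K" "bounded_linear L"
  shows "continuous_on UNIV (quad_tikhonov K a L)"
  unfolding quad_tikhonov_def[abs_def]
  by (intro continuous_intros bounded_linear.continuous_on[OF assms(1)] bounded_linear.continuous_on[OF assms(2)]) auto

text \<open>
  The subgradient inequality at \<open>v = \<mu>\<close> reads \<open>|\<mu> - u|\<^sup>2 \<le> 0\<close> after completing the square.
\<close>

lemma subdifferential_half_norm_square:
  fixes u :: "'a::real_inner"
  assumes "\<mu> \<in> subdifferential (\<lambda>u. (norm u)\<^sup>2 / 2) u"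
  shows "\<mu> = u"
proof -
  have "(norm u)\<^sup>2 / 2 + \<mu> \<bullet> (\<mu> - u) \<le> (norm \<mu>)\<^sup>2 / 2"
    using assms by (simp add: subdifferential_def)
  then have "(norm (\<mu> - u))\<^sup>2 \<le> 0"
    by (simp add: power2_norm_eq_inner inner_diff_left inner_diff_right inner_commute)
  then show ?thesis by simp
qed

section \<open>Measurability of minimisers\<close>

lemma (in complete_measure) borel_measurable_of_AE_eq:
  fixes f g :: "'a \<Rightarrow> 'b::topological_space"
  assumes g: "g \<in> borel_measurable M" and eq: "AE x in M. f x = g x"
  shows "f \<in> borel_measurable M"
proof (rule measurableI)
  fix A :: "'b set" assume A: "A \<in> sets borel"
  obtain Z where Z: "Z \<in> null_sets M" "{x \<in> space M. f x \<noteq> g x} \<subseteq> Z"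
    using eq by (auto elim!: AE_E simp: null_sets_def)
  have Z': "Z \<in> sets M" using Z by auto
  have "f -` A \<inter> space M \<inter> Z \<in> sets M"
    by (rule complete[OF _ Z(1)]) auto
  moreover have "g -` A \<inter> space M - Z \<in> sets M"
    using measurable_sets[OF g A] Z' by auto
  moreover have "f -` A \<inter> space M = (f -` A \<inter> space M \<inter> Z) \<union> (g -` A \<inter> space M - Z)"
    using Z by auto
  ultimately show "f -` A \<inter> space M \<in> sets M" by (metis sets.Un)
qed auto

text \<open>
  A minimiser is specified for each realisation separately, but quadratic growth makes it unique and
  forces near-minimisers to be close to it.  The first member of a countable dense family that is
  minimal within the family up to \<open>1/m\<close> depends measurably on the realisation, because
  this condition is a countable conjunction, and it tends to the minimiser as \<open>m\<close> grows.
\<close>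

lemma (in complete_measure) borel_measurable_at_minimiser:
  fixes J :: "'a \<Rightarrow> 'b::metric_space \<Rightarrow> real" and z :: "'i::countable \<Rightarrow> 'b" and g :: "'b \<Rightarrow> real"
  assumes dense: "closure (range z) = UNIV"
    and J: "\<And>i. (\<lambda>\<omega>. J \<omega> (z i)) \<in> borel_measurable M"
    and c: "c > 0"
    and min: "AE \<omega> in M. continuous_on UNIV (J \<omega>) \<and>
      (\<forall>v. J \<omega> (U \<omega>) + c * (dist v (U \<omega>))\<^sup>2 \<le> J \<omega> v)"
    and g: "continuous_on UNIV g"
  shows "(\<lambda>\<omega>. g (U \<omega>)) \<in> borel_measurable M"
proof -
  define y where "y n = z (from_nat n)" for n
  have z_y: "z i = y (to_nat i)" for i by (simp add: y_def)
  have ran: "range y = range z"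
    unfolding y_def by (metis (no_types) from_nat_to_nat image_image surj_def)
  define P where "P m n \<omega> \<longleftrightarrow> (\<forall>j. J \<omega> (y n) \<le> J \<omega> (y j) + 1 / Suc m)" for m n \<omega>
  define s where "s m \<omega> = (LEAST n. P m n \<omega>)" for m \<omega>
  have [measurable]: "(\<lambda>\<omega>. J \<omega> (y n)) \<in> borel_measurable M" for n
    unfolding y_def by (rule J)
  have [measurable]: "s m \<in> M \<rightarrow>\<^sub>M count_space UNIV" for m
    unfolding s_def P_def by measurable
  have gs: "(\<lambda>\<omega>. g (y (s m \<omega>))) \<in> borel_measurable M" for m
    by (rule measurable_compose_countable[where f="\<lambda>n \<omega>. g (y n)"]) auto
  have "AE \<omega> in M. (\<lambda>m. g (y (s m \<omega>))) \<longlonglongrightarrow> g (U \<omega>)"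
    using min
  proof eventually_elim
    case (elim \<omega>)
    then have cont: "continuous_on UNIV (J \<omega>)"
      and gr: "\<And>v. J \<omega> (U \<omega>) + c * (dist v (U \<omega>))\<^sup>2 \<le> J \<omega> v" by auto
    have near: "\<exists>n. J \<omega> (y n) < J \<omega> (U \<omega>) + r" if r: "r > 0" for r
    proof -
      have "open {v. J \<omega> v < J \<omega> (U \<omega>) + r}"
        using cont by (intro open_Collect_less continuous_intros)
      moreover have "U \<omega> \<in> {v. J \<omega> v < J \<omega> (U \<omega>) + r}" using r by simp
      moreover have "U \<omega> \<in> closure (range y)" using dense ran by simp
      ultimately show ?thesis
        unfolding closure_iff_nhds_not_empty by blast
    qed
    have minle: "J \<omega> (U \<omega>) \<le> J \<omega> v" for v
      using gr[of v] c by (smt (verit) mult_nonneg_nonneg zero_le_power2)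
    have bound: "(dist (y (s m \<omega>)) (U \<omega>))\<^sup>2 \<le> 1 / c * (1 / Suc m)" for m
    proof -
      obtain n where "J \<omega> (y n) < J \<omega> (U \<omega>) + 1 / Suc m" using near[of "1 / Suc m"] by auto
      then have "P m n \<omega>" unfolding P_def using minle by (smt (verit))
      then have P: "P m (s m \<omega>) \<omega>" unfolding s_def by (rule LeastI)
      have "J \<omega> (y (s m \<omega>)) \<le> J \<omega> (U \<omega>) + 1 / Suc m"
      proof (rule field_le_epsilon)
        fix e :: real assume "e > 0"
        then obtain j where "J \<omega> (y j) < J \<omega> (U \<omega>) + e" using near by blast
        moreover have "J \<omega> (y (s m \<omega>)) \<le> J \<omega> (y j) + 1 / Suc m" using P by (simp add: P_def)
        ultimately show "J \<omega> (y (s m \<omega>)) \<le> J \<omega> (U \<omega>) + 1 / Suc m + e" by linarith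
      qed
      then have "c * (dist (y (s m \<omega>)) (U \<omega>))\<^sup>2 \<le> 1 / Suc m" using gr[of "y (s m \<omega>)"] by linarith
      then have "(dist (y (s m \<omega>)) (U \<omega>))\<^sup>2 \<le> (1 / Suc m) / c"
        using c by (simp only: pos_le_divide_eq mult.commute)
      then show ?thesis by (simp add: mult.commute)
    qed
    have "(\<lambda>m. 1 / c * (1 / Suc m)) \<longlonglongrightarrow> 1 / c * 0"
      by (intro tendsto_intros LIMSEQ_Suc[OF lim_1_over_n])
    then have lim0: "(\<lambda>m. 1 / c * (1 / Suc m)) \<longlonglongrightarrow> 0" by simp
    have "(\<lambda>m. (dist (y (s m \<omega>)) (U \<omega>))\<^sup>2) \<longlonglongrightarrow> 0"
      by (rule tendsto_sandwich[OF _ _ tendsto_const lim0]) (use bound in auto)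
    then have "(\<lambda>m. sqrt ((dist (y (s m \<omega>)) (U \<omega>))\<^sup>2)) \<longlonglongrightarrow> sqrt 0"
      by (rule tendsto_real_sqrt)
    then have "(\<lambda>m. y (s m \<omega>)) \<longlonglongrightarrow> U \<omega>"
      by (subst tendsto_dist_iff) simp
    then show ?case
      using continuous_on_tendsto_compose[OF g, of "\<lambda>m. y (s m \<omega>)" "U \<omega>"] by simp
  qed
  then have "AE \<omega> in M. g (U \<omega>) = lim (\<lambda>m. g (y (s m \<omega>)))"
    by eventually_elim (simp add: limI)
  then show ?thesis
    by (rule borel_measurable_of_AE_eq[rotated]) (intro borel_measurable_lim_metric gs)
qed

section \<open>Square integrable functions and their classes\<close>

lemma L2_rel_refl: "square_integrable_fun f \<Longrightarrow> L2_rel f f"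
  by (simp add: L2_rel_def)

lemma L2_cases:
  obtains f where "square_integrable_fun f" "u = abs_L2 f"
proof
  show "square_integrable_fun (rep_L2 u)"
    using Quotient3_rep_reflp[OF Quotient3_L2, of u] by (simp add: L2_rel_def)
  show "u = abs_L2 (rep_L2 u)"
    by (simp add: Quotient3_abs_rep[OF Quotient3_L2])
qed

definition unit_cube :: "(real^'d::finite) set" where
  "unit_cube = {x. \<forall>i. 0 \<le> x $ i \<and> x $ i < 1}"

lemma unit_cube_borel [measurable]: "unit_cube \<in> sets borel"
proof -
  have "unit_cube = (\<Inter>i. {x::real^'d. 0 \<le> x $ i} \<inter> {x. x $ i < 1})"
    by (auto simp: unit_cube_def)
  also have "\<dots> \<in> sets borel"
    by (intro sets.finite_INT) (auto intro!: borel_closed borel_open closed_Collect_le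
        open_Collect_less continuous_intros sets.Int)
  finally show ?thesis .
qed

lemma torus_measure_eq: "torus_measure = restrict_space lborel unit_cube"
  by (simp add: torus_measure_def unit_cube_def)

lemma space_torus_measure [simp]: "space torus_measure = unit_cube"
  by (simp add: torus_measure_eq space_restrict_space)

lemma borel_measurable_torus:
  "f \<in> borel_measurable borel \<Longrightarrow> f \<in> borel_measurable torus_measure"
  unfolding torus_measure_eq by (intro measurable_restrict_space1) auto

lemma integral_torus_measure:
  fixes f :: "real^'d::finite \<Rightarrow> real"
  shows "(\<integral>x. f x \<partial>torus_measure) = (\<integral>x. indicator unit_cube x * f x \<partial>lborel)"
  unfolding torus_measure_eq by (subst integral_restrict_space) auto

lemma emeasure_unit_cube: "emeasure lborel (unit_cube :: (real^'d::finite) set) = 1"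
proof (rule antisym)
  have one: "(One :: real^'d) = 1"
  proof (rule vec_eq_iff[THEN iffD2, rule_format])
    fix i :: 'd
    show "(One :: real^'d) $ i = 1 $ i"
      using inner_sum_left_Basis[of "axis i 1 :: real^'d" "\<lambda>_. 1"]
      by (simp add: axis_in_Basis_iff inner_axis)
  qed
  have "emeasure lborel (unit_cube :: (real^'d) set) \<le> emeasure lborel (cbox 0 (One :: real^'d))"
    by (intro emeasure_mono) (auto simp: unit_cube_def mem_box_cart one less_imp_le)
  also have "\<dots> = 1" by (simp add: emeasure_lborel_cbox_eq)
  finally show "emeasure lborel (unit_cube :: (real^'d) set) \<le> 1" .
  have "1 = emeasure lborel (box 0 (One :: real^'d))"
    by (simp add: emeasure_lborel_box_eq)
  also have "\<dots> \<le> emeasure lborel (unit_cube :: (real^'d) set)"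
    by (intro emeasure_mono) (auto simp: unit_cube_def mem_box_cart one less_imp_le)
  finally show "1 \<le> emeasure lborel (unit_cube :: (real^'d) set)" .
qed

lemma prob_space_torus_measure: "prob_space (torus_measure :: (real^'d::finite) measure)"
  by standard (simp add: torus_measure_eq emeasure_restrict_space space_restrict_space emeasure_unit_cube)

lemma square_integrable_bounded:
  assumes "f \<in> borel_measurable torus_measure" "\<And>x. x \<in> unit_cube \<Longrightarrow> \<bar>f x\<bar> \<le> B"
  shows "square_integrable_fun f"
proof -
  interpret prob_space "torus_measure :: (real^'a) measure" by (rule prob_space_torus_measure)
  have "(f x)\<^sup>2 \<le> B\<^sup>2" if "x \<in> unit_cube" for x
    using assms(2)[OF that] by (metis abs_ge_zero abs_of_nonneg order_trans power2_abs power_mono)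
  then show ?thesis
    unfolding square_integrable_fun_def using assms(1)
    by (auto intro!: integrable_const_bound[where B="B\<^sup>2"] AE_I2)
qed

lemma inner_abs_L2:
  assumes "square_integrable_fun f" "square_integrable_fun g"
  shows "abs_L2 f \<bullet> abs_L2 g = (\<integral>x. f x * g x \<partial>torus_measure)"
  by (rule inner_L2.abs_eq) (auto intro: L2_rel_refl assms)

lemma abs_L2_add:
  assumes "square_integrable_fun f" "square_integrable_fun g"
  shows "abs_L2 (\<lambda>x. f x + g x) = abs_L2 f + abs_L2 g"
  by (rule plus_L2.abs_eq[symmetric]) (auto intro: L2_rel_refl assms)

lemma abs_L2_scale:
  assumes "square_integrable_fun f"
  shows "abs_L2 (\<lambda>x. c * f x) = c *\<^sub>R abs_L2 f"
  by (rule scaleR_L2.abs_eq[symmetric]) (auto intro: L2_rel_refl assms)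

lemma abs_L2_diff:
  assumes "square_integrable_fun f" "square_integrable_fun g"
  shows "abs_L2 (\<lambda>x. f x - g x) = abs_L2 f - abs_L2 g"
  by (rule minus_L2.abs_eq[symmetric]) (auto intro: L2_rel_refl assms)

lemma dist_abs_L2:
  assumes "square_integrable_fun f" "square_integrable_fun g"
  shows "dist (abs_L2 f) (abs_L2 g) = sqrt (\<integral>x. (f x - g x)\<^sup>2 \<partial>torus_measure)"
proof -
  have "square_integrable_fun (\<lambda>x. f x - g x)" by (rule square_integrable_diff[OF assms])
  then show ?thesis
    by (simp add: dist_norm abs_L2_diff[OF assms, symmetric] norm_eq_sqrt_inner inner_abs_L2
        power2_eq_square)
qed

lemma abs_L2_cong:
  assumes "square_integrable_fun f" "\<And>x. x \<in> unit_cube \<Longrightarrow> f x = g x"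
  shows "abs_L2 f = abs_L2 g"
proof (rule Quotient3_rel_abs[OF Quotient3_L2])
  have "square_integrable_fun g"
    using assms measurable_cong[of torus_measure f g borel]
      Bochner_Integration.integrable_cong[of torus_measure torus_measure "\<lambda>x. (f x)\<^sup>2" "\<lambda>x. (g x)\<^sup>2"]
    by (simp add: square_integrable_fun_def)
  then show "L2_rel f g"
    using assms by (auto simp: L2_rel_def)
qed

text \<open>
  Dominated convergence in \<open>L\<^sup>2\<close>: the common tool for the three approximation steps below, from trigonometric
  polynomials to continuous functions, from continuous functions to indicators, and from simple
  functions to all of \<open>L\<^sup>2\<close>.
\<close>

lemma abs_L2_tendsto_dominated:
  fixes g :: "real^'d::finite \<Rightarrow> real"
  assumes f: "\<And>n. square_integrable_fun (f n)" and g: "square_integrable_fun g"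
    and w: "square_integrable_fun w"
    and lim: "\<And>x. x \<in> unit_cube \<Longrightarrow> (\<lambda>n::nat. f n x) \<longlonglongrightarrow> g x"
    and bound: "\<And>n x. x \<in> unit_cube \<Longrightarrow> \<bar>f n x - g x\<bar> \<le> \<bar>w x\<bar>"
  shows "(\<lambda>n. abs_L2 (f n)) \<longlonglongrightarrow> abs_L2 g"
proof -
  have [measurable]: "f n \<in> borel_measurable torus_measure" "g \<in> borel_measurable torus_measure" for n
    using f g by (auto simp: square_integrable_fun_def)
  have "(\<lambda>n. \<integral>x. (f n x - g x)\<^sup>2 \<partial>torus_measure) \<longlonglongrightarrow> (\<integral>x. 0 \<partial>(torus_measure :: (real^'d) measure))"
  proof (rule integral_dominated_convergence[where w="\<lambda>x. (w x)\<^sup>2"])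
    show "AE x in torus_measure. (\<lambda>n. (f n x - g x)\<^sup>2) \<longlonglongrightarrow> 0"
    proof (rule AE_I2)
      fix x assume "x \<in> space (torus_measure :: (real^'d) measure)"
      then have "(\<lambda>n. (f n x - g x)\<^sup>2) \<longlonglongrightarrow> (g x - g x)\<^sup>2"
        by (intro tendsto_intros lim) auto
      then show "(\<lambda>n. (f n x - g x)\<^sup>2) \<longlonglongrightarrow> 0" by simp
    qed
  qed (use w bound in \<open>auto simp: square_integrable_fun_def abs_le_square_iff intro!: AE_I2\<close>)
  then have "(\<lambda>n. sqrt (\<integral>x. (f n x - g x)\<^sup>2 \<partial>torus_measure)) \<longlonglongrightarrow> sqrt 0"
    by (intro tendsto_real_sqrt) simp
  then show ?thesis
    by (subst tendsto_dist_iff) (simp add: dist_abs_L2[OF f g])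
qed
section \<open>Trigonometric functions on the torus\<close>

definition cos_wave :: "int^'d::finite \<Rightarrow> real^'d \<Rightarrow> real" where
  "cos_wave k x = cos (2 * pi * (freq k \<bullet> x))"

definition sin_wave :: "int^'d::finite \<Rightarrow> real^'d \<Rightarrow> real" where
  "sin_wave k x = sin (2 * pi * (freq k \<bullet> x))"

lemma freq_axis: "freq (axis i 1) = axis i 1"
  by (simp add: freq_def axis_def vec_eq_iff)

lemma freq_simps:
  "freq (k + l) = freq k + freq l" "freq (k - l) = freq k - freq l" "freq (- k) = - freq k" "freq 0 = 0"
  "freq k \<bullet> axis i 1 = of_int (k $ i)" "freq (axis i 1) \<bullet> x = x $ i"
  unfolding freq_axis by (auto simp: freq_def vec_eq_iff inner_axis inner_axis')

lemma wave_simps: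
  "cos_wave 0 = (\<lambda>x. 1)" "sin_wave 0 = (\<lambda>x. 0)"
  "cos_wave (- k) = cos_wave k" "sin_wave (- k) x = - sin_wave k x"
  by (auto simp: cos_wave_def sin_wave_def freq_simps)

lemma wave_mult:
  "cos_wave k x * cos_wave l x = 1 / 2 * cos_wave (k - l) x + 1 / 2 * cos_wave (k + l) x"
  "sin_wave k x * sin_wave l x = 1 / 2 * cos_wave (k - l) x + - 1 / 2 * cos_wave (k + l) x"
  "sin_wave k x * cos_wave l x = 1 / 2 * sin_wave (k + l) x + 1 / 2 * sin_wave (k - l) x"
  "cos_wave l x * sin_wave k x = 1 / 2 * sin_wave (k + l) x + 1 / 2 * sin_wave (k - l) x"
  by (simp_all add: cos_wave_def sin_wave_def freq_simps inner_add_left inner_diff_left distrib_left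
      right_diff_distrib cos_times_cos sin_times_sin sin_times_cos cos_times_sin add_divide_distrib diff_divide_distrib)
    (simp_all add: cos_add cos_diff sin_add sin_diff field_simps)

lemma continuous_on_wave [continuous_intros]:
  "continuous_on A (cos_wave k)" "continuous_on A (sin_wave k)"
  unfolding cos_wave_def sin_wave_def by (intro continuous_intros)+

lemma borel_measurable_wave [measurable]:
  "cos_wave k \<in> borel_measurable borel" "sin_wave k \<in> borel_measurable borel"
  by (intro borel_measurable_continuous_onI continuous_intros)+

lemma abs_wave_le: "\<bar>cos_wave k x\<bar> \<le> 1" "\<bar>sin_wave k x\<bar> \<le> 1"
  by (auto simp: cos_wave_def sin_wave_def)

lemma square_integrable_wave:
  "square_integrable_fun (cos_wave k)" "square_integrable_fun (sin_wave k)"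
  by (rule square_integrable_bounded[where B=1]; auto intro: borel_measurable_torus abs_wave_le)+

lemma wave_has_directional_derivative:
  "((\<lambda>s. A * cos_wave k (x + s *\<^sub>R axis i 1) + B * sin_wave k (x + s *\<^sub>R axis i 1))
    has_field_derivative (2 * pi * k $ i * B) * cos_wave k x + (- 2 * pi * k $ i * A) * sin_wave k x) (at 0)"
  unfolding cos_wave_def sin_wave_def inner_add_right inner_scaleR_right freq_simps
  by (auto intro!: derivative_eq_intros simp: algebra_simps)

text \<open>
  Differentiation preserves the plane spanned by the two waves of a fixed frequency, so smoothness
  follows from continuity and differentiability of the members of this plane.
\<close>

lemma iter_deriv_wave:
  "\<exists>A' B'. iter_deriv is (\<lambda>x. A * cos_wave k x + B * sin_wave k x) = (\<lambda>x. A' * cos_wave k x + B' * sin_wave k x)"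
proof (induction "is" arbitrary: A B)
  case Nil
  show ?case by (auto simp: iter_deriv_def)
next
  case (Cons i "is")
  have step: "partial_deriv i (\<lambda>x. A * cos_wave k x + B * sin_wave k x) =
      (\<lambda>x. (2 * pi * k $ i * B) * cos_wave k x + (- 2 * pi * k $ i * A) * sin_wave k x)"
    unfolding partial_deriv_def by (rule ext) (rule DERIV_imp_deriv[OF wave_has_directional_derivative])
  have "iter_deriv (i # is) (\<lambda>x. A * cos_wave k x + B * sin_wave k x) =
      iter_deriv is (\<lambda>x. (2 * pi * k $ i * B) * cos_wave k x + (- 2 * pi * k $ i * A) * sin_wave k x)"
    by (simp only: iter_deriv_def fold_simps step)
  then show ?case
    by (simp only: Cons.IH)
qed

lemma wave_combination_test_function:
  "(\<lambda>x. A * cos_wave k x + B * sin_wave k x) \<in> test_functions"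
proof -
  have per: "cos_wave k (x + axis i 1) = cos_wave k x" "sin_wave k (x + axis i 1) = sin_wave k x" for x i
    using cos.plus_of_int[of "2 * pi * (freq k \<bullet> x)" "k $ i"] sin.plus_of_int[of "2 * pi * (freq k \<bullet> x)" "k $ i"]
    by (simp_all add: cos_wave_def sin_wave_def inner_add_right freq_simps algebra_simps)
  have cont: "continuous_on UNIV (\<lambda>x. A * cos_wave k x + B * sin_wave k x)" for A B
    by (intro continuous_intros)
  have diff: "(\<lambda>s. A * cos_wave k (x + s *\<^sub>R axis i 1) + B * sin_wave k (x + s *\<^sub>R axis i 1))
      differentiable (at 0)" for A B x i
    using wave_has_directional_derivative real_differentiable_def by blast
  have "continuous_on UNIV (iter_deriv is (\<lambda>x. A * cos_wave k x + B * sin_wave k x)) \<and>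
      (\<forall>i x. (\<lambda>s. iter_deriv is (\<lambda>x. A * cos_wave k x + B * sin_wave k x) (x + s *\<^sub>R axis i 1)) differentiable (at 0))"
    for "is"
  proof -
    obtain A' B' where "iter_deriv is (\<lambda>x. A * cos_wave k x + B * sin_wave k x) = (\<lambda>x. A' * cos_wave k x + B' * sin_wave k x)"
      using iter_deriv_wave by blast
    then show ?thesis using cont diff by simp
  qed
  then show ?thesis
    unfolding test_functions_def by (simp add: per)
qed

lemma wave_test_function: "cos_wave k \<in> test_functions" "sin_wave k \<in> test_functions"
  using wave_combination_test_function[of 1 k 0] wave_combination_test_function[of 0 k 1] by auto

text \<open>
  A translated cube is the cube with a slab cut off on one side and put back, translated by a
  period, on the other.
\<close>

lemma integral_torus_shift:
  fixes f :: "real^'d::finite \<Rightarrow> real"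
  assumes f [measurable]: "f \<in> borel_measurable borel" and B: "\<And>x. \<bar>f x\<bar> \<le> B"
    and per: "\<And>x. f (x + axis i 1) = f x" and s: "0 \<le> s" "s \<le> 1"
  shows "(\<integral>x. f (x + s *\<^sub>R axis i 1) \<partial>torus_measure) = (\<integral>x. f x \<partial>torus_measure)"
proof -
  let ?e = "axis i 1 :: real^'d"
  have trans: "(\<integral>x. g (x + c) \<partial>lborel) = (\<integral>x. g x \<partial>lborel)"
    if [measurable]: "g \<in> borel_measurable borel" for g :: "real^'d \<Rightarrow> real" and c
    using integral_distr[of "(+) c" lborel borel g] that
    by (simp add: lborel_distr_plus add.commute)
  define A where "A = {x\<in>unit_cube. s \<le> x $ i}"
  define B' where "B' = {x\<in>unit_cube. x $ i < s}"
  have A_eq: "A = unit_cube \<inter> {x. s \<le> x $ i}" and B'_eq: "B' = unit_cube \<inter> {x. x $ i < s}"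
    by (auto simp: A_def B'_def)
  have [measurable]: "A \<in> sets borel" "B' \<in> sets borel"
    unfolding A_eq B'_eq
    by (intro sets.Int unit_cube_borel borel_closed borel_open closed_Collect_le open_Collect_less
        continuous_intros)+
  have ind: "indicator unit_cube (x - s *\<^sub>R ?e) = (indicator A x + indicator B' (x - ?e) :: real)" for x
  proof -
    have c: "x - c *\<^sub>R ?e \<in> unit_cube \<longleftrightarrow>
        (\<forall>j. j \<noteq> i \<longrightarrow> 0 \<le> x $ j \<and> x $ j < 1) \<and> 0 \<le> x $ i - c \<and> x $ i - c < 1" for c
      unfolding unit_cube_def by (auto simp: axis_def; metis diff_0_right)
    have "x \<in> unit_cube \<longleftrightarrow>
        (\<forall>j. j \<noteq> i \<longrightarrow> 0 \<le> x $ j \<and> x $ j < 1) \<and> 0 \<le> x $ i \<and> x $ i < 1"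
      using c[of 0] by simp
    moreover have "(x - ?e) $ i = x $ i - 1" by (simp add: axis_def)
    ultimately show ?thesis
      using c[of s] c[of 1] s by (auto simp: indicator_def A_def B'_def)
  qed
  have fin: "emeasure lborel A < \<infinity>" "emeasure lborel B' < \<infinity>"
    using emeasure_mono[of A unit_cube lborel] emeasure_mono[of B' unit_cube lborel]
    by (auto simp: emeasure_unit_cube A_def B'_def intro: le_less_trans)
  have bd: "integrable lborel (\<lambda>x. indicator C x * f x)"
    if "C \<in> sets borel" "emeasure lborel C < \<infinity>" for C
    using that B by (intro integrableI_bounded_set[where A=C and B=B])
      (auto simp: indicator_def intro!: AE_I2)
  have int1: "integrable lborel (\<lambda>x. indicator A x * f x)" "integrable lborel (\<lambda>x. indicator B' x * f x)"
    by (rule bd; use fin in simp)+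
  have B'_shift: "(\<lambda>x. indicator B' (x - ?e) * f x) = (\<lambda>x. indicator B' (x + - ?e) * f (x + - ?e))"
    using per by (metis (no_types, opaque_lifting) diff_add_cancel uminus_add_conv_diff add.commute)
  have int2: "integrable lborel (\<lambda>x. indicator B' (x - ?e) * f x)"
    unfolding B'_shift
    using integrable_distr[of "(+) (- ?e)" lborel borel "\<lambda>x. indicator B' x * f x"] int1(2)
    by (simp add: lborel_distr_plus add.commute)
  have "(\<integral>x. f (x + s *\<^sub>R ?e) \<partial>torus_measure)
      = (\<integral>x. indicator unit_cube (x + s *\<^sub>R ?e - s *\<^sub>R ?e) * f (x + s *\<^sub>R ?e) \<partial>lborel)"
    by (simp add: integral_torus_measure)
  also have "\<dots> = (\<integral>x. indicator unit_cube (x - s *\<^sub>R ?e) * f x \<partial>lborel)"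
    by (rule trans[where g="\<lambda>x. indicator unit_cube (x - s *\<^sub>R ?e) * f x"]) measurable
  also have "\<dots> = (\<integral>x. indicator A x * f x + indicator B' (x - ?e) * f x \<partial>lborel)"
    by (simp add: ind distrib_right)
  also have "\<dots> = (\<integral>x. indicator A x * f x \<partial>lborel) + (\<integral>x. indicator B' (x - ?e) * f x \<partial>lborel)"
    by (rule Bochner_Integration.integral_add[OF int1(1) int2])
  also have "(\<integral>x. indicator B' (x - ?e) * f x \<partial>lborel) = (\<integral>x. indicator B' x * f x \<partial>lborel)"
    unfolding B'_shift by (rule trans[where g="\<lambda>x. indicator B' x * f x"]) measurable
  also have "(\<integral>x. indicator A x * f x \<partial>lborel) + (\<integral>x. indicator B' x * f x \<partial>lborel)
      = (\<integral>x. indicator A x * f x + indicator B' x * f x \<partial>lborel)"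
    by (rule Bochner_Integration.integral_add[OF int1, symmetric])
  also have "\<dots> = (\<integral>x. indicator unit_cube x * f x \<partial>lborel)"
    by (intro Bochner_Integration.integral_cong) (auto simp: A_def B'_def indicator_def)
  finally show ?thesis by (simp add: integral_torus_measure)
qed

text \<open>
  Translation by half a wavelength in a direction with nonzero frequency changes the sign of the
  wave, but not its mean.
\<close>

lemma integral_wave:
  fixes k :: "int^'d::finite"
  shows "(\<integral>x. cos_wave k x \<partial>torus_measure) = (if k = 0 then 1 else 0)"
    and "(\<integral>x. sin_wave k x \<partial>torus_measure) = 0"
proof -
  interpret prob_space "torus_measure :: (real^'d) measure" by (rule prob_space_torus_measure)
  have one: "(\<integral>x. 1 \<partial>(torus_measure :: (real^'d) measure)) = (1::real)"
    using prob_space by simp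
  have *: "(\<integral>x. cos_wave k x \<partial>torus_measure) = 0 \<and> (\<integral>x. sin_wave k x \<partial>torus_measure) = 0" if "k \<noteq> 0"
  proof -
    obtain i where i: "k $ i \<noteq> 0" using \<open>k \<noteq> 0\<close> by (auto simp: vec_eq_iff)
    define s where "s = 1 / (2 * \<bar>real_of_int (k $ i)\<bar>)"
    have s: "0 \<le> s" "s \<le> 1" using i by (auto simp: s_def field_simps)
    define h where "h = 2 * pi * (k $ i * s)"
    have h: "h = pi \<or> h = - pi"
      using i by (auto simp: h_def s_def abs_if field_simps)
    have arg: "2 * pi * (freq k \<bullet> (x + s *\<^sub>R axis i 1)) = 2 * pi * (freq k \<bullet> x) + h" for x
      by (simp add: inner_add_right freq_simps h_def algebra_simps)
    have flip: "cos_wave k (x + s *\<^sub>R axis i 1) = - cos_wave k x"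
      "sin_wave k (x + s *\<^sub>R axis i 1) = - sin_wave k x" for x
      unfolding cos_wave_def sin_wave_def arg using h by (auto simp: cos_add sin_add)
    have per: "cos_wave k (x + axis i 1) = cos_wave k x" "sin_wave k (x + axis i 1) = sin_wave k x" for x
      using wave_test_function[of k] by (auto simp: test_functions_def)
    show ?thesis
      using integral_torus_shift[of "cos_wave k" 1 i s] integral_torus_shift[of "sin_wave k" 1 i s] s
      by (simp add: flip per abs_wave_le)
  qed
  show "(\<integral>x. cos_wave k x \<partial>torus_measure) = (if k = 0 then 1 else 0)"
    using * one by (auto simp: wave_simps)
  show "(\<integral>x. sin_wave k x \<partial>torus_measure) = 0"
    using * by (cases "k = 0") (auto simp: wave_simps)
qed

section \<open>Density of the trigonometric polynomials\<close>

inductive_set trig_polys :: "(real^'d::finite \<Rightarrow> real) set" where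
  cos: "cos_wave k \<in> trig_polys"
| sin: "sin_wave k \<in> trig_polys"
| add: "f \<in> trig_polys \<Longrightarrow> g \<in> trig_polys \<Longrightarrow> (\<lambda>x. f x + g x) \<in> trig_polys"
| scale: "f \<in> trig_polys \<Longrightarrow> (\<lambda>x. c * f x) \<in> trig_polys"

text \<open>
  The product-to-sum formulas write a product of two waves as a combination of waves.
\<close>

lemma trig_polys_mult:
  assumes "f \<in> trig_polys" "g \<in> trig_polys"
  shows "(\<lambda>x. f x * g x) \<in> trig_polys"
  using assms(1)
proof induction
  case (cos k)
  show ?case using assms(2)
  proof induction
    case (add f g)
    then show ?case using trig_polys.add[OF add.IH] by (simp add: distrib_left)
  next
    case (scale f c)
    then show ?case using trig_polys.scale[OF scale.IH, of c] by (simp add: mult.left_commute)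
    next
    case (cos l)
    show ?case unfolding wave_mult by (intro trig_polys.intros)
  next
    case (sin l)
    show ?case unfolding wave_mult by (intro trig_polys.intros)
  qed
next
  case (sin k)
  show ?case using assms(2)
  proof induction
    case (add f g)
    then show ?case using trig_polys.add[OF add.IH] by (simp add: distrib_left)
  next
    case (scale f c)
    then show ?case using trig_polys.scale[OF scale.IH, of c] by (simp add: mult.left_commute)
    next
    case (cos l)
    show ?case unfolding wave_mult by (intro trig_polys.intros)
  next
    case (sin l)
    show ?case unfolding wave_mult by (intro trig_polys.intros)
  qed
next
  case (add f g)
  then show ?case using trig_polys.add[OF add.IH] by (simp add: distrib_right)
next
  case (scale f c)
  then show ?case using trig_polys.scale[OF scale.IH, of c] by (simp add: mult.assoc)
qed

definition cos_L2 :: "int^'d::finite \<Rightarrow> 'd L2" where "cos_L2 k = abs_L2 (cos_wave k)"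
definition sin_L2 :: "int^'d::finite \<Rightarrow> 'd L2" where "sin_L2 k = abs_L2 (sin_wave k)"

definition trig_closure :: "'d::finite L2 set" where
  "trig_closure = closure (span (range cos_L2 \<union> range sin_L2))"

lemma closed_trig_closure: "closed trig_closure"
  by (simp add: trig_closure_def)

lemma trig_closure_limit:
  "(\<And>n::nat. u n \<in> trig_closure) \<Longrightarrow> u \<longlonglongrightarrow> v \<Longrightarrow> v \<in> trig_closure"
  by (rule closed_sequentially[OF closed_trig_closure])

lemma subspace_closure_normed:
  fixes S :: "'a::real_normed_vector set"
  assumes "subspace S"
  shows "subspace (closure S)"
proof (rule subspaceI)
  show "0 \<in> closure S" using closure_subset subspace_0[OF assms] by blast
next
  fix x y assume "x \<in> closure S" "y \<in> closure S"
  then obtain u v where "\<And>n. u n \<in> S" "u \<longlonglongrightarrow> x" "\<And>n. v n \<in> S" "v \<longlonglongrightarrow> y"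
    by (auto simp: closure_sequential)
  then show "x + y \<in> closure S"
    unfolding closure_sequential
    by (intro exI[of _ "\<lambda>n. u n + v n"] conjI allI tendsto_add subspace_add[OF assms])
next
  fix c x assume "x \<in> closure S"
  then obtain u where "\<And>n. u n \<in> S" "u \<longlonglongrightarrow> x"
    by (auto simp: closure_sequential)
  then show "c *\<^sub>R x \<in> closure S"
    unfolding closure_sequential
    by (intro exI[of _ "\<lambda>n. c *\<^sub>R u n"] conjI allI tendsto_scaleR tendsto_const subspace_scale[OF assms])
qed

lemma subspace_trig_closure: "subspace trig_closure"
  unfolding trig_closure_def by (intro subspace_closure_normed subspace_span)

lemma trig_polys_L2:
  "f \<in> trig_polys \<Longrightarrow> square_integrable_fun f \<and> abs_L2 f \<in> span (range cos_L2 \<union> range sin_L2)"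
proof (induction rule: trig_polys.induct)
  case (cos k)
  then show ?case by (auto simp: square_integrable_wave cos_L2_def[symmetric] intro!: span_base)
next
  case (sin k)
  then show ?case by (auto simp: square_integrable_wave sin_L2_def[symmetric] intro!: span_base)
next
  case (add f g)
  then show ?case by (auto simp: abs_L2_add square_integrable_add span_add)
next
  case (scale f c)
  then show ?case by (auto simp: abs_L2_scale square_integrable_scale span_scale)
qed

text \<open>
  The torus as a compact subset of \<open>\<complex>\<^sup>d\<close>.  Continuous functions there pull back to periodic functions,
  and no two points of the half-open cube are identified.
\<close>

definition torus_embedding :: "real^'d::finite \<Rightarrow> complex^'d" where
  "torus_embedding x = (\<chi> i. cis (2 * pi * x $ i))"

lemma continuous_on_torus_embedding: "continuous_on A torus_embedding"
  unfolding torus_embedding_def by (intro continuous_intros)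

lemma inj_on_torus_embedding: "inj_on torus_embedding unit_cube"
proof (rule inj_onI)
  fix x y :: "real^'a"
  assume x: "x \<in> unit_cube" and y: "y \<in> unit_cube" and eq: "torus_embedding x = torus_embedding y"
  show "x = y"
  proof (rule vec_eq_iff[THEN iffD2, rule_format])
    fix i
    have "cis (2 * pi * x $ i) = cis (2 * pi * y $ i)"
      using arg_cong[OF eq, of "\<lambda>z. z $ i"] by (simp add: torus_embedding_def)
    then obtain n :: int where "2 * pi * x $ i = 2 * pi * y $ i + 2 * pi * n"
      using sin_cos_eq_iff by (auto simp: complex_eq_iff)
    then have "2 * pi * (x $ i) = 2 * pi * (y $ i + n)" by (simp add: distrib_left)
    then have n: "x $ i = y $ i + n" by simp
    have "0 \<le> x $ i" "x $ i < 1" "0 \<le> y $ i" "y $ i < 1"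
      using x y by (auto simp: unit_cube_def)
    then have "\<bar>real_of_int n\<bar> < 1" using n by linarith
    then have "n = 0" by linarith
    then show "x $ i = y $ i" using n by simp
  qed
qed

text \<open>
  On the image of the torus in \<open>\<complex>\<^sup>d\<close>, the functions that pull back to trigonometric polynomials
  form an algebra containing the coordinates, so the Stone--Weierstrass theorem applies.
\<close>

lemma continuous_in_trig_closure:
  fixes \<phi> :: "complex^'d::finite \<Rightarrow> real"
  assumes "continuous_on UNIV \<phi>"
  shows "abs_L2 (\<lambda>x. \<phi> (torus_embedding x)) \<in> trig_closure"
proof -
  define S where "S = (torus_embedding ` cbox 0 1 :: (complex^'d) set)"
  have S: "compact S"
    unfolding S_def by (intro compact_continuous_image continuous_on_torus_embedding compact_cbox)
  have in_S: "torus_embedding x \<in> S" if "x \<in> unit_cube" for x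
    using that by (auto simp: S_def unit_cube_def mem_box_cart less_imp_le)
  have cont: "continuous_on S \<phi>" using assms continuous_on_subset by blast
  define P where "P p \<longleftrightarrow> continuous_on S p \<and> (\<lambda>x. p (torus_embedding x)) \<in> trig_polys"
    for p :: "complex^'d \<Rightarrow> real"
  have const: "P (\<lambda>x. c)" for c
    using trig_polys.scale[OF trig_polys.cos[of 0], of c] by (simp add: P_def wave_simps)
  have sep: "\<exists>f. P f \<and> f x \<noteq> f y" if xy: "x \<noteq> y" for x y
  proof -
    obtain i where "x $ i \<noteq> y $ i" using xy by (auto simp: vec_eq_iff)
    moreover have "P (\<lambda>z. Re (z $ i))" "P (\<lambda>z. Im (z $ i))"
      using trig_polys.cos[of "axis i 1"] trig_polys.sin[of "axis i 1"]
      by (auto simp: P_def torus_embedding_def cos_wave_def[abs_def] sin_wave_def[abs_def] freq_simps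
          intro!: continuous_intros)
    ultimately show ?thesis by (auto simp: complex_eq_iff)
  qed
  have approx: "\<exists>p. P p \<and> (\<forall>z\<in>S. \<bar>\<phi> z - p z\<bar> < e)" if "e > 0" for e
    using that
    by (intro Stone_Weierstrass_HOL[OF S, of P]) (auto simp: const sep cont,
        auto simp: P_def intro!: continuous_intros trig_polys.add trig_polys_mult)
  then have "\<exists>p. P p \<and> (\<forall>z\<in>S. \<bar>\<phi> z - p z\<bar> < inverse (real (Suc n)))" for n by simp
  then obtain p where p: "\<And>n. P (p n)" "\<And>n z. z \<in> S \<Longrightarrow> \<bar>\<phi> z - p n z\<bar> < inverse (real (Suc n))"
    by metis
  have "bounded (\<phi> ` S)" by (intro compact_imp_bounded compact_continuous_image cont S)
  then obtain B where B: "\<And>z. z \<in> S \<Longrightarrow> \<bar>\<phi> z\<bar> \<le> B" by (auto simp: bounded_iff)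
  have "(\<lambda>x. \<phi> (torus_embedding x)) \<in> borel_measurable borel"
    by (intro borel_measurable_continuous_onI continuous_on_compose2[OF assms continuous_on_torus_embedding]) auto
  then have sq: "square_integrable_fun (\<lambda>x. \<phi> (torus_embedding x))"
    by (intro square_integrable_bounded[where B=B] borel_measurable_torus B in_S)
  have sqp: "square_integrable_fun (\<lambda>x. p n (torus_embedding x))" for n
    using p(1) trig_polys_L2 by (auto simp: P_def)
  have "(\<lambda>n. abs_L2 (\<lambda>x. p n (torus_embedding x))) \<longlonglongrightarrow> abs_L2 (\<lambda>x. \<phi> (torus_embedding x))"
  proof (rule abs_L2_tendsto_dominated[OF sqp sq square_integrable_wave(1)[of 0]])
    fix x :: "real^'d" assume x: "x \<in> unit_cube"
    have le: "\<bar>p n (torus_embedding x) - \<phi> (torus_embedding x)\<bar> \<le> inverse (real (Suc n))" for n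
      using p(2)[OF in_S[OF x], of n] by (simp add: abs_minus_commute)
    have "(\<lambda>n. p n (torus_embedding x) - \<phi> (torus_embedding x)) \<longlonglongrightarrow> 0"
      by (rule Lim_null_comparison[OF _ LIMSEQ_inverse_real_of_nat]) (use le in simp)
    then show "(\<lambda>n. p n (torus_embedding x)) \<longlonglongrightarrow> \<phi> (torus_embedding x)"
      by (simp add: LIM_zero_iff)
    fix n
    have "inverse (real (Suc n)) \<le> 1" by (simp add: field_simps)
    then show "\<bar>p n (torus_embedding x) - \<phi> (torus_embedding x)\<bar> \<le> \<bar>cos_wave 0 x\<bar>"
      using le[of n] by (simp add: wave_simps)
  qed
  moreover have "abs_L2 (\<lambda>x. p n (torus_embedding x)) \<in> trig_closure" for n
    using p(1)[of n] trig_polys_L2 closure_subset unfolding P_def trig_closure_def by blast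
  ultimately show ?thesis by (rule trig_closure_limit[rotated])
qed

lemma square_integrable_indicator:
  assumes "A \<in> sets borel"
  shows "square_integrable_fun (indicator A :: _ \<Rightarrow> real)"
  using assms by (intro square_integrable_bounded[where B=1] borel_measurable_torus) (auto simp: indicator_def)

text \<open>
  The indicator is the pointwise limit of the continuous functions \<open>max 0 (1 - n dist(z, E))\<close>, where \<open>E\<close> is
  the compact image of \<open>C\<close> in \<open>\<complex>\<^sup>d\<close>.  Points of the cube outside \<open>C\<close> have a positive distance from \<open>E\<close> because
  the embedding is injective on the cube.
\<close>

lemma compact_indicator_in_trig_closure:
  fixes C :: "(real^'d::finite) set"
  assumes C: "compact C" "C \<subseteq> unit_cube"
  shows "abs_L2 (indicator C) \<in> trig_closure"
proof (cases "C = {}")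
  case True
  have "(0 :: 'd L2) \<in> trig_closure" by (rule subspace_0[OF subspace_trig_closure])
  moreover have "abs_L2 (indicator C) = (0 :: 'd L2)"
    using True by (simp add: zero_L2.abs_eq indicator_def[abs_def])
  ultimately show ?thesis by simp
next
  case False
  let ?E = "torus_embedding ` C"
  define \<phi> where "\<phi> n z = max 0 (1 - real n * infdist z ?E)" for n :: nat and z :: "complex^'d"
  have cl: "closed ?E"
    by (intro compact_imp_closed compact_continuous_image continuous_on_torus_embedding C)
  have cont: "continuous_on UNIV (\<phi> n)" for n
    unfolding \<phi>_def by (intro continuous_intros)
  have bounds: "0 \<le> \<phi> n z" "\<phi> n z \<le> 1" for n z
    by (auto simp: \<phi>_def infdist_nonneg)
  have meas: "(\<lambda>x. \<phi> n (torus_embedding x)) \<in> borel_measurable borel" for n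
    by (intro borel_measurable_continuous_onI continuous_on_compose2[OF cont continuous_on_torus_embedding]) auto
  have sq: "square_integrable_fun (\<lambda>x. \<phi> n (torus_embedding x))" for n
    using bounds by (intro square_integrable_bounded[where B=1] borel_measurable_torus meas) auto
  have "(\<lambda>n. abs_L2 (\<lambda>x. \<phi> n (torus_embedding x))) \<longlonglongrightarrow> abs_L2 (indicator C)"
  proof (rule abs_L2_tendsto_dominated[OF sq square_integrable_indicator square_integrable_wave(1)[of 0]])
    show "C \<in> sets borel" using C by (simp add: borel_compact)
    fix x :: "real^'d" assume x: "x \<in> unit_cube"
    show "(\<lambda>n. \<phi> n (torus_embedding x)) \<longlonglongrightarrow> indicator C x"
    proof (cases "x \<in> C")
      case True
      then show ?thesis by (simp add: \<phi>_def infdist_zero)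
    next
      case xC: False
      then have "torus_embedding x \<notin> ?E"
        using inj_on_torus_embedding x C(2) by (auto dest: inj_onD)
      then have d: "infdist (torus_embedding x) ?E > 0"
        using cl False infdist_pos_not_in_closed by blast
      obtain N :: nat where "1 / infdist (torus_embedding x) ?E < N" using reals_Archimedean2 by blast
      then have N: "1 < N * infdist (torus_embedding x) ?E" using d by (simp add: field_simps)
      have "\<phi> n (torus_embedding x) = 0" if "n \<ge> N" for n
      proof -
        have "N * infdist (torus_embedding x) ?E \<le> n * infdist (torus_embedding x) ?E"
          using that d by (intro mult_right_mono) auto
        then show ?thesis using N by (simp add: \<phi>_def)
      qed
      then have "(\<lambda>n. \<phi> n (torus_embedding x)) \<longlonglongrightarrow> 0"
        by (intro tendsto_eventually eventually_sequentiallyI)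
      then show ?thesis using xC by simp
    qed
    fix n
    show "\<bar>\<phi> n (torus_embedding x) - indicator C x\<bar> \<le> \<bar>cos_wave 0 x\<bar>"
      using bounds[of n "torus_embedding x"] by (auto simp: wave_simps indicator_def)
  qed
  then show ?thesis
    by (rule trig_closure_limit[OF continuous_in_trig_closure[OF cont]])
qed

text \<open>
  By inner regularity of Lebesgue measure on the cube, \<open>A\<close> is exhausted up to arbitrarily small
  measure by compact sets, and the squared distance of two nested indicators is the measure of the difference.
\<close>

lemma borel_indicator_in_trig_closure:
  fixes A :: "(real^'d::finite) set"
  assumes A [measurable]: "A \<in> sets borel"
  shows "abs_L2 (indicator A) \<in> trig_closure"
proof -
  let ?A = "A \<inter> unit_cube"
  have [measurable]: "?A \<in> sets borel" using A by measurable
  define \<nu> where "\<nu> = density lborel (indicator (unit_cube :: (real^'d) set) :: _ \<Rightarrow> ennreal)"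
  have \<nu>: "emeasure \<nu> C = emeasure lborel C" if "C \<in> sets borel" "C \<subseteq> unit_cube" for C
  proof -
    have "indicator unit_cube x * indicator C x = (indicator C x :: ennreal)" for x
      using that by (auto simp: indicator_def)
    then show ?thesis
      using that by (simp add: \<nu>_def emeasure_density)
  qed
  have sets: "sets \<nu> = sets borel" by (simp add: \<nu>_def)
  have fin: "emeasure \<nu> (space \<nu>) \<noteq> \<infinity>"
    by (simp add: \<nu>_def emeasure_density emeasure_unit_cube)
  have finA: "emeasure \<nu> ?A \<noteq> \<infinity>"
    using emeasure_space[of \<nu> ?A] fin by (auto simp: top_unique)
  have "abs_L2 (indicator ?A) \<in> closure (trig_closure :: 'd L2 set)"
  proof (rule closure_approachable[THEN iffD2, rule_format])
    fix e :: real assume "e > 0"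
    have "\<exists>C\<in>{C. C \<subseteq> ?A \<and> compact C}. emeasure \<nu> ?A < emeasure \<nu> C + ennreal (e\<^sup>2)"
      using \<open>e > 0\<close> finA
      by (intro SUP_approx_ennreal[OF _ _ inner_regular[OF sets fin]]) auto
    then obtain C where C: "C \<subseteq> ?A" "compact C" "emeasure \<nu> ?A < emeasure \<nu> C + ennreal (e\<^sup>2)" by auto
    have [measurable]: "C \<in> sets borel" using C by (simp add: borel_compact)
    have finC: "emeasure lborel C < \<infinity>" "emeasure lborel ?A < \<infinity>"
      using \<nu>[of C] \<nu>[of ?A] C finA emeasure_space[of \<nu> C] fin by (auto simp: top_unique less_top)
    have "emeasure lborel ?A = measure lborel ?A" "emeasure lborel C = measure lborel C"
      using finC by (auto simp: emeasure_eq_ennreal_measure)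
    then have "measure lborel ?A < measure lborel C + e\<^sup>2"
      using C \<nu>[of C] \<nu>[of ?A] by (simp add: ennreal_less_iff flip: ennreal_plus)
    then have less: "measure lborel (?A - C) < e\<^sup>2"
      using C finC by (subst measure_Diff) auto
    have "dist (abs_L2 (indicator C)) (abs_L2 (indicator ?A) :: 'd L2)
        = sqrt (\<integral>x. (indicator C x - indicator ?A x :: real)\<^sup>2 \<partial>(torus_measure :: (real^'d) measure))"
      by (intro dist_abs_L2 square_integrable_indicator) auto
    also have "(\<integral>x. (indicator C x - indicator ?A x :: real)\<^sup>2 \<partial>(torus_measure :: (real^'d) measure))
        = (\<integral>x. (indicator (?A - C) x :: real) \<partial>lborel)"
      unfolding integral_torus_measure using C(1)
      by (intro Bochner_Integration.integral_cong) (auto simp: indicator_def)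
    also have "\<dots> = measure lborel (?A - C)" by simp
    also have "sqrt \<dots> < e" using less \<open>e > 0\<close> by (simp add: real_less_lsqrt)
    finally show "\<exists>y\<in>trig_closure. dist y (abs_L2 (indicator ?A)) < e"
      using compact_indicator_in_trig_closure C by (metis le_inf_iff)
  qed
  moreover have "abs_L2 (indicator ?A) = (abs_L2 (indicator A) :: 'd L2)"
    by (intro abs_L2_cong square_integrable_indicator) (auto simp: indicator_def)
  ultimately show ?thesis
    unfolding closure_closed[OF closed_trig_closure] by simp
qed

text \<open>
  Simple functions lie in the closure, and every square integrable function is the limit of
  simple functions bounded by twice its absolute value.
\<close>

lemma trig_closure_UNIV: "trig_closure = (UNIV :: 'd::finite L2 set)"
proof -
  have "u \<in> trig_closure" for u :: "'d L2"
  proof -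
    obtain f where f: "square_integrable_fun f" "u = abs_L2 f" by (rule L2_cases)
    have "f \<in> borel_measurable torus_measure" using f by (simp add: square_integrable_fun_def)
    from borel_measurable_implies_sequence_metric[OF this, of 0]
    obtain s where "\<forall>n. simple_function torus_measure (s n)"
      "\<forall>x\<in>space torus_measure. (\<lambda>n. s n x) \<longlonglongrightarrow> f x"
      "\<forall>n. \<forall>x\<in>space torus_measure. dist (s n x) 0 \<le> 2 * dist (f x) 0"
      by blast
    then have s: "\<And>n. simple_function torus_measure (s n)"
      "\<And>x. x \<in> unit_cube \<Longrightarrow> (\<lambda>n. s n x) \<longlonglongrightarrow> f x"
      "\<And>n x. x \<in> unit_cube \<Longrightarrow> \<bar>s n x\<bar> \<le> 2 * \<bar>f x\<bar>"
      by (auto simp: dist_norm)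
    have simple: "square_integrable_fun g \<and> abs_L2 g \<in> trig_closure"
      if g: "simple_function torus_measure g" for g :: "real^'d \<Rightarrow> real"
    proof -
      define A where "A y = g -` {y} \<inter> unit_cube" for y
      have A: "A y \<in> sets borel" for y
      proof -
        have "A y \<in> sets torus_measure"
          using simple_functionD(2)[OF g, of "{y}"] by (simp add: A_def)
        then show ?thesis
          unfolding torus_measure_eq by (subst (asm) sets_restrict_space_iff) auto
      qed
      have sum: "square_integrable_fun (\<lambda>x. \<Sum>y\<in>Y. y * indicator (A y) x) \<and>
          abs_L2 (\<lambda>x. \<Sum>y\<in>Y. y * indicator (A y) x) \<in> trig_closure" if "finite Y" for Y
        using that
      proof induction
        case empty
        have "abs_L2 (\<lambda>x. 0) = (0 :: 'd L2)" by (simp add: zero_L2.abs_eq)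
        then show ?case by (simp add: square_integrable_0 subspace_0[OF subspace_trig_closure])
      next
        case (insert y Y)
        have sq: "square_integrable_fun (\<lambda>x. y * indicator (A y) x)"
          by (intro square_integrable_scale square_integrable_indicator A)
        have "abs_L2 (\<lambda>x. y * indicator (A y) x) \<in> trig_closure"
          unfolding abs_L2_scale[OF square_integrable_indicator[OF A]]
          by (intro subspace_scale[OF subspace_trig_closure] borel_indicator_in_trig_closure A)
        then show ?case
          unfolding sum.insert[OF insert.hyps] using insert.IH sq
          by (auto simp only: abs_L2_add intro!: square_integrable_add subspace_add[OF subspace_trig_closure])
      qed
      let ?h = "\<lambda>x. \<Sum>y\<in>g ` unit_cube. y * indicator (A y) x"
      have fin: "finite (g ` unit_cube)" using simple_functionD(1)[OF g] by simp
      have h: "?h x = g x" if "x \<in> unit_cube" for x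
      proof -
        have "?h x = (\<Sum>y\<in>g ` unit_cube. if y = g x then y else 0)"
          using that by (intro sum.cong) (auto simp: A_def indicator_def)
        then show ?thesis using fin that by simp
      qed
      have hs: "square_integrable_fun ?h" "abs_L2 ?h \<in> trig_closure" using sum[OF fin] by auto
      have "g \<in> borel_measurable torus_measure" using g by (rule borel_measurable_simple_function)
      moreover have "integrable torus_measure (\<lambda>x. (g x)\<^sup>2)"
        using hs(1) Bochner_Integration.integrable_cong[of torus_measure torus_measure "\<lambda>x. (?h x)\<^sup>2" "\<lambda>x. (g x)\<^sup>2"] h
        by (simp add: square_integrable_fun_def)
      ultimately have "square_integrable_fun g" by (simp add: square_integrable_fun_def)
      moreover have "abs_L2 ?h = abs_L2 g" using hs(1) h by (rule abs_L2_cong)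
      ultimately show ?thesis using hs(2) by simp
    qed
    have sq: "square_integrable_fun (s n)" for n
      using simple[OF s(1)] by (rule conjunct1)
    have "(\<lambda>n. abs_L2 (s n)) \<longlonglongrightarrow> abs_L2 f"
    proof (rule abs_L2_tendsto_dominated[OF sq f(1) square_integrable_scale[OF f(1), of 3]])
      fix n and x :: "real^'d" assume "x \<in> unit_cube"
      then show "\<bar>s n x - f x\<bar> \<le> \<bar>3 * f x\<bar>" using s(3)[of x n] by linarith
    qed (rule s(2))
    moreover have "abs_L2 (s n) \<in> trig_closure" for n
      using simple[OF s(1)] by (rule conjunct2)
    ultimately show ?thesis
      unfolding f(2) by (rule trig_closure_limit[rotated])
  qed
  then show ?thesis by auto
qed

section \<open>Parseval's identity and separability\<close>

lemma wave_L2_minus: "cos_L2 (- k) = cos_L2 k" "sin_L2 (- k) = - sin_L2 k"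
proof -
  show "cos_L2 (- k) = cos_L2 k" by (simp add: cos_L2_def wave_simps)
  have "sin_wave (- k) = (\<lambda>x. - 1 * sin_wave k x)" by (auto simp: wave_simps)
  then have "sin_L2 (- k) = - 1 *\<^sub>R sin_L2 k"
    unfolding sin_L2_def by (simp only: abs_L2_scale[OF square_integrable_wave(2)])
  then show "sin_L2 (- k) = - sin_L2 k" by simp
qed

lemma inner_wave_L2:
  fixes k l :: "int^'d::finite"
  shows "cos_L2 k \<bullet> cos_L2 l = (of_bool (k = l) + of_bool (k = - l)) / 2"
    and "sin_L2 k \<bullet> sin_L2 l = (of_bool (k = l) - of_bool (k = - l)) / 2"
    and "cos_L2 k \<bullet> sin_L2 l = 0" and "sin_L2 l \<bullet> cos_L2 k = 0"
proof -
  interpret prob_space "torus_measure :: (real^'d) measure" by (rule prob_space_torus_measure)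
  have int: "integrable torus_measure (cos_wave m)" "integrable torus_measure (sin_wave m)" for m :: "int^'d"
    by (rule integrable_const_bound[where B=1]; auto simp: abs_wave_le intro: borel_measurable_torus)+
  have eq: "k - l = 0 \<longleftrightarrow> k = l" "k + l = 0 \<longleftrightarrow> k = - l"
    by (auto simp: add_eq_0_iff2)
  note [simp] = int integral_wave eq
  show "cos_L2 k \<bullet> cos_L2 l = (of_bool (k = l) + of_bool (k = - l)) / 2"
    by (simp add: cos_L2_def inner_abs_L2 square_integrable_wave wave_mult(1))
  show "sin_L2 k \<bullet> sin_L2 l = (of_bool (k = l) - of_bool (k = - l)) / 2"
    by (simp add: sin_L2_def inner_abs_L2 square_integrable_wave wave_mult(2))
  show "cos_L2 k \<bullet> sin_L2 l = 0"
    by (simp add: cos_L2_def sin_L2_def inner_abs_L2 square_integrable_wave wave_mult(4))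
  then show "sin_L2 l \<bullet> cos_L2 k = 0" by (simp add: inner_commute)
qed

text \<open>
  The contribution of the frequency \<open>k\<close> to the Sobolev pairing of the distributions of \<open>g\<close> and \<open>h\<close>, see
  \<open>Re_fourier_coeff_mult_cnj\<close>.
\<close>

definition fourier_term :: "'d::finite L2 \<Rightarrow> 'd L2 \<Rightarrow> int^'d \<Rightarrow> real" where
  "fourier_term g h k = (g \<bullet> cos_L2 k) * (h \<bullet> cos_L2 k) + (g \<bullet> sin_L2 k) * (h \<bullet> sin_L2 k)"

definition fourier_sum :: "(int^'d::finite) set \<Rightarrow> 'd L2 \<Rightarrow> 'd L2" where
  "fourier_sum F g = (\<Sum>k\<in>F. (g \<bullet> cos_L2 k) *\<^sub>R cos_L2 k + (g \<bullet> sin_L2 k) *\<^sub>R sin_L2 k)"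

lemma inner_fourier_sum: "h \<bullet> fourier_sum F g = (\<Sum>k\<in>F. fourier_term g h k)"
  by (simp add: fourier_sum_def fourier_term_def inner_sum_right inner_add_right)

text \<open>
  The waves of frequency \<open>k\<close> and \<open>- k\<close> coincide up to sign and have squared norm \<open>1/2\<close>; the two
  effects cancel when the set of frequencies is symmetric.
\<close>

lemma fourier_sum_reproduces:
  assumes F: "finite F" "uminus ` F = F" and l: "l \<in> F"
  shows "fourier_sum F g \<bullet> cos_L2 l = g \<bullet> cos_L2 l" "fourier_sum F g \<bullet> sin_L2 l = g \<bullet> sin_L2 l"
proof -
  have l': "- l \<in> F" using F(2) l by blast
  have delta: "(\<Sum>k\<in>F. f k * of_bool (k = m)) = f m" if "m \<in> F" for f :: "_ \<Rightarrow> real" and m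
  proof -
    have "(\<Sum>k\<in>F. f k * of_bool (k = m)) = (\<Sum>k\<in>F. if k = m then f k else 0)"
      by (intro sum.cong) auto
    then show ?thesis using F(1) that by simp
  qed
  have "fourier_sum F g \<bullet> cos_L2 l
      = (\<Sum>k\<in>F. (g \<bullet> cos_L2 k) / 2 * of_bool (k = l)) + (\<Sum>k\<in>F. (g \<bullet> cos_L2 k) / 2 * of_bool (k = - l))"
    by (simp add: fourier_sum_def inner_sum_left inner_add_left inner_wave_L2 distrib_left add_divide_distrib
        flip: sum.distrib)
  then show "fourier_sum F g \<bullet> cos_L2 l = g \<bullet> cos_L2 l"
    by (simp only: delta[OF l] delta[OF l'] wave_L2_minus)
  have "fourier_sum F g \<bullet> sin_L2 l
      = (\<Sum>k\<in>F. (g \<bullet> sin_L2 k) / 2 * of_bool (k = l)) - (\<Sum>k\<in>F. (g \<bullet> sin_L2 k) / 2 * of_bool (k = - l))"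
    by (simp add: fourier_sum_def inner_sum_left inner_add_left inner_wave_L2 right_diff_distrib diff_divide_distrib
        flip: sum_subtractf)
  then show "fourier_sum F g \<bullet> sin_L2 l = g \<bullet> sin_L2 l"
    by (simp only: delta[OF l] delta[OF l'] wave_L2_minus inner_minus_right)
qed

text \<open>
  For a symmetric set of frequencies the partial Fourier sum of \<open>g\<close> is the orthogonal projection of \<open>g\<close>, whose
  squared norm is the sum in question; enlarging \<open>F\<close> to a symmetric set adds nonnegative terms.
\<close>

lemma bessel:
  assumes "finite F"
  shows "(\<Sum>k\<in>F. fourier_term g g k) \<le> (norm g)\<^sup>2"
proof -
  let ?F = "F \<union> uminus ` F"
  have F: "finite ?F" "uminus ` ?F = ?F" using assms by (auto simp: image_Un image_image)
  let ?G = "fourier_sum ?F g"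
  have "?G \<bullet> ?G = (\<Sum>k\<in>?F. fourier_term g ?G k)" by (rule inner_fourier_sum)
  also have "\<dots> = (\<Sum>k\<in>?F. fourier_term g g k)"
    by (intro sum.cong refl) (simp add: fourier_term_def fourier_sum_reproduces[OF F])
  also have "\<dots> = g \<bullet> ?G" by (rule inner_fourier_sum[symmetric])
  finally have GG: "?G \<bullet> ?G = g \<bullet> ?G" .
  have "0 \<le> (g - ?G) \<bullet> (g - ?G)" by simp
  also have "\<dots> = (norm g)\<^sup>2 - g \<bullet> ?G"
    using GG by (simp add: inner_diff_left inner_diff_right power2_norm_eq_inner inner_commute)
  finally have "(\<Sum>k\<in>?F. fourier_term g g k) \<le> (norm g)\<^sup>2" by (simp add: inner_fourier_sum)
  moreover have "(\<Sum>k\<in>F. fourier_term g g k) \<le> (\<Sum>k\<in>?F. fourier_term g g k)"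
    using F by (intro sum_mono2) (auto simp: fourier_term_def)
  ultimately show ?thesis by linarith
qed

lemma fourier_term_self: "fourier_term g g summable_on UNIV" "infsum (fourier_term g g) UNIV \<le> (norm g)\<^sup>2"
proof -
  show "fourier_term g g summable_on UNIV"
    by (rule nonneg_bdd_above_summable_on)
      (auto simp: fourier_term_def intro!: bdd_aboveI2[where M="(norm g)\<^sup>2"] bessel[unfolded fourier_term_def])
  then show "infsum (fourier_term g g) UNIV \<le> (norm g)\<^sup>2"
    by (rule infsum_le_finite_sums) (use bessel in auto)
qed

lemma abs_fourier_term_le: "\<bar>fourier_term g h k\<bar> \<le> fourier_term g g k + fourier_term h h k"
proof -
  have "\<bar>a * b\<bar> \<le> (a * a + b * b) / 2" for a b :: real
    using sum_squares_bound[of "\<bar>a\<bar>" "\<bar>b\<bar>"] by (simp add: abs_mult power2_eq_square)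
  from this[of "g \<bullet> cos_L2 k" "h \<bullet> cos_L2 k"] this[of "g \<bullet> sin_L2 k" "h \<bullet> sin_L2 k"]
    abs_triangle_ineq[of "(g \<bullet> cos_L2 k) * (h \<bullet> cos_L2 k)" "(g \<bullet> sin_L2 k) * (h \<bullet> sin_L2 k)"]
  have "\<bar>fourier_term g h k\<bar> \<le> (fourier_term g g k + fourier_term h h k) / 2"
    unfolding fourier_term_def by argo
  moreover have "0 \<le> fourier_term g g k" "0 \<le> fourier_term h h k" by (auto simp: fourier_term_def)
  ultimately show ?thesis by argo
qed

lemma fourier_term_summable: "fourier_term g h summable_on UNIV"
proof -
  have "(\<lambda>k. norm (fourier_term g h k)) summable_on UNIV"
  proof (rule Infinite_Sum.abs_summable_on_comparison_test')
    show "(\<lambda>k. fourier_term g g k + fourier_term h h k) summable_on UNIV"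
      by (intro summable_on_add fourier_term_self)
  qed (simp add: abs_fourier_term_le)
  then show ?thesis by (rule abs_summable_summable)
qed

text \<open>
  By Bessel's inequality both sides are continuous and linear in \<open>g\<close>.  They agree on the waves, where only the
  frequencies \<open>l\<close> and \<open>- l\<close> contribute, hence on the closure of their span, which is the whole space.
\<close>

lemma parseval:
  fixes g h :: "'d::finite L2"
  shows "infsum (fourier_term g h) UNIV = g \<bullet> h"
proof -
  define \<Phi> where "\<Phi> g = infsum (fourier_term g h) UNIV - g \<bullet> h" for g :: "'d L2"
  have lin: "linear \<Phi>"
  proof (rule linearI)
    fix u v :: "'d L2" and c :: real
    have "fourier_term (u + v) h = (\<lambda>k. fourier_term u h k + fourier_term v h k)"
      by (auto simp: fourier_term_def inner_add_left algebra_simps)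
    then show "\<Phi> (u + v) = \<Phi> u + \<Phi> v"
      by (simp add: \<Phi>_def infsum_add fourier_term_summable inner_add_left)
    have "fourier_term (c *\<^sub>R u) h = (\<lambda>k. c * fourier_term u h k)"
      by (auto simp: fourier_term_def algebra_simps)
    then show "\<Phi> (c *\<^sub>R u) = c *\<^sub>R \<Phi> u"
      by (simp add: \<Phi>_def infsum_cmult_right' algebra_simps)
  qed
  have crude: "\<bar>\<Phi> u\<bar> \<le> (norm u)\<^sup>2 + (norm h)\<^sup>2 + norm u * norm h" for u
  proof -
    have "\<bar>infsum (fourier_term u h) UNIV\<bar> \<le> infsum (\<lambda>k. fourier_term u u k + fourier_term h h k) UNIV"
      using norm_infsum_le[OF has_sum_infsum has_sum_infsum, of "fourier_term u h" UNIV
          "\<lambda>k. fourier_term u u k + fourier_term h h k"]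
      by (simp add: fourier_term_summable fourier_term_self summable_on_add abs_fourier_term_le)
    also have "\<dots> \<le> (norm u)\<^sup>2 + (norm h)\<^sup>2"
      by (simp add: infsum_add fourier_term_self add_mono)
    finally show ?thesis
      using Cauchy_Schwarz_ineq2[of u h] unfolding \<Phi>_def by linarith
  qed
  have "bounded_linear \<Phi>"
  proof (rule bounded_linear_intro[where K="1 + (norm h)\<^sup>2 + norm h"])
    fix u :: "'d L2"
    \<comment> \<open>The crude bound at the normalised vector gives the linear bound by homogeneity.\<close>
    show "norm (\<Phi> u) \<le> norm u * (1 + (norm h)\<^sup>2 + norm h)"
    proof (cases "u = 0")
      case True
      then show ?thesis using linear_0[OF lin] by simp
    next
      case False
      have "\<Phi> u = norm u * \<Phi> (u /\<^sub>R norm u)"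
        using False linear_scale[OF lin, of "inverse (norm u)" u] by simp
      moreover have "\<bar>\<Phi> (u /\<^sub>R norm u)\<bar> \<le> 1 + (norm h)\<^sup>2 + norm h"
        using crude[of "u /\<^sub>R norm u"] False by simp
      ultimately show ?thesis by (simp add: abs_mult mult_left_mono)
    qed
  qed (use lin in \<open>auto simp: linear_add linear_scale\<close>)
  then have cont: "continuous_on UNIV \<Phi>" by (simp add: linear_continuous_on)
  have finite_case: "\<Phi> v = 0"
    if v: "v = cos_L2 l \<or> v = sin_L2 l" for v l
  proof -
    let ?F = "{l, - l}"
    have F: "finite ?F" "uminus ` ?F = ?F" "l \<in> ?F" by auto
    have "infsum (fourier_term v h) UNIV = infsum (fourier_term v h) ?F"
    proof (rule infsum_cong_neutral)
      fix k assume "k \<in> UNIV - ?F"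
      then have "l \<noteq> k" "l \<noteq> - k" by auto
      then show "fourier_term v h k = 0" using v by (auto simp: fourier_term_def inner_wave_L2)
    qed auto
    also have "\<dots> = (\<Sum>k\<in>?F. fourier_term h v k)"
      by (simp add: fourier_term_def mult.commute)
    also have "\<dots> = v \<bullet> fourier_sum ?F h" by (rule inner_fourier_sum[symmetric])
    also have "\<dots> = v \<bullet> h"
      using v fourier_sum_reproduces[OF F, of h] by (auto simp: inner_commute)
    finally show "\<Phi> v = 0" by (simp add: \<Phi>_def)
  qed
  have "\<Phi> v = 0" if "v \<in> span (range cos_L2 \<union> range sin_L2)" for v
    by (rule linear_eq_0_on_span[OF lin _ that]) (use finite_case in blast)
  then have "\<Phi> g = 0" if "g \<in> closure (span (range cos_L2 \<union> range sin_L2))" for g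
    using continuous_constant_on_closure[of "span (range cos_L2 \<union> range sin_L2)" \<Phi> 0 g] that cont
    by (auto intro: continuous_on_subset)
  moreover have "g \<in> closure (span (range cos_L2 \<union> range sin_L2))"
    using trig_closure_UNIV[where 'd='d] unfolding trig_closure_def by simp
  ultimately show ?thesis unfolding \<Phi>_def by auto
qed

text \<open>
  Lists of coefficients and indices form a countable type, so the combinations are given
  together with a countable index type.
\<close>

definition rational_combination :: "('i \<Rightarrow> 'a::real_vector) \<Rightarrow> (rat \<times> 'i) list \<Rightarrow> 'a" where
  "rational_combination b l = (\<Sum>(q, i)\<leftarrow>l. of_rat q *\<^sub>R b i)"

lemma closure_rational_combinations:
  fixes b :: "'i \<Rightarrow> 'a::real_normed_vector"
  assumes "closure (span (range b)) = UNIV"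
  shows "closure (range (rational_combination b)) = UNIV"
proof -
  have "x \<in> closure (range (rational_combination b))" if "x \<in> span (range b)" for x
    using that
  proof (induction rule: span_induct_alt)
    case base
    have "rational_combination b [] = 0" by (simp add: rational_combination_def)
    then show ?case using closure_subset by (metis in_mono rangeI)
  next
    case (step c x y)
    then obtain i where i: "x = b i" by auto
    show ?case
    proof (rule closure_approachable[THEN iffD2, rule_format])
      fix e :: real assume e: "e > 0"
      obtain l where l: "dist (rational_combination b l) y < e / 2"
        using step.IH e closure_approachable by (metis half_gt_zero rangeE)
      define r where "r = e / 2 / (norm x + 1)"
      have r: "r > 0" using e by (simp add: r_def add_nonneg_pos)
      obtain q :: rat where q: "c < of_rat q" "of_rat q < c + r"
        using of_rat_dense[of c "c + r"] r by auto
      have "rational_combination b ((q, i) # l) - (c *\<^sub>R x + y)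
          = (of_rat q - c) *\<^sub>R x + (rational_combination b l - y)"
        by (simp add: rational_combination_def i scaleR_diff_left)
      then have "dist (rational_combination b ((q, i) # l)) (c *\<^sub>R x + y)
          \<le> \<bar>of_rat q - c\<bar> * norm x + dist (rational_combination b l) y"
        by (metis dist_norm norm_triangle_ineq norm_scaleR)
      also have "\<bar>of_rat q - c\<bar> * norm x \<le> r * norm x"
        using q by (intro mult_right_mono) auto
      also have "r * norm x \<le> r * (norm x + 1)"
        using r by (intro mult_left_mono) auto
      also have "r * (norm x + 1) = e / 2"
        proof -
        have "norm x + 1 \<noteq> 0" using norm_ge_zero[of x] by linarith
        then show ?thesis using r_def nonzero_eq_divide_eq by blast
      qed
      finally show "\<exists>y'\<in>range (rational_combination b). dist y' (c *\<^sub>R x + y) < e"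
        using l by (intro bexI[of _ "rational_combination b ((q, i) # l)"]) auto
    qed
  qed
  then have "closure (span (range b)) \<subseteq> closure (range (rational_combination b))"
    by (intro closure_minimal) auto
  then show ?thesis using assms by auto
qed

definition trig_L2 :: "bool \<times> (int^'d::finite) \<Rightarrow> 'd L2" where
  "trig_L2 p = (if fst p then cos_L2 (snd p) else sin_L2 (snd p))"

lemma L2_separable: "closure (range (rational_combination trig_L2)) = (UNIV :: 'd::finite L2 set)"
proof (rule closure_rational_combinations)
  have "range trig_L2 = (range cos_L2 \<union> range sin_L2 :: 'd L2 set)"
  proof
    show "range trig_L2 \<subseteq> (range cos_L2 \<union> range sin_L2 :: 'd L2 set)"
      by (auto simp: trig_L2_def)
    have "cos_L2 k = trig_L2 (True, k)" "sin_L2 k = trig_L2 (False, k)" for k :: "int^'d"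
      by (auto simp: trig_L2_def)
    then show "(range cos_L2 \<union> range sin_L2 :: 'd L2 set) \<subseteq> range trig_L2"
      by (metis (no_types, lifting) Un_least image_subsetI rangeI)
  qed
  then show "closure (span (range trig_L2)) = (UNIV :: 'd L2 set)"
    using trig_closure_UNIV[where 'd='d] by (simp add: trig_closure_def)
qed

lemma fourier_coeff_L2_dist:
  "fourier_coeff (L2_dist g) k = Complex (g \<bullet> cos_L2 k) (- (g \<bullet> sin_L2 k))"
proof -
  have ip: "L2_dist g \<phi> = g \<bullet> abs_L2 \<phi>" if "\<phi> \<in> test_functions" "square_integrable_fun \<phi>" for \<phi>
  proof -
    obtain f where f: "square_integrable_fun f" "g = abs_L2 f" by (rule L2_cases)
    then show ?thesis
      using that by (simp add: inner_abs_L2 L2_dist.abs_eq L2_rel_refl)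
  qed
  show ?thesis
    using ip[OF wave_test_function(1)[of k] square_integrable_wave(1)]
      ip[OF wave_test_function(2)[of k] square_integrable_wave(2)]
    by (simp add: fourier_coeff_def cos_L2_def sin_L2_def cos_wave_def[abs_def] sin_wave_def[abs_def])
qed

lemma Re_fourier_coeff_mult_cnj:
  "Re (fourier_coeff (L2_dist g) k * cnj (fourier_coeff (L2_dist h) k)) = fourier_term g h k"
  by (simp add: fourier_coeff_L2_dist fourier_term_def)

section \<open>White noise in negative Sobolev spaces\<close>

lemma centered_gaussian_square_integrable:
  assumes "centered_gaussian M X"
  shows "integrable M (\<lambda>\<omega>. (X \<omega>)\<^sup>2)"
proof -
  have [measurable]: "X \<in> borel_measurable M" using assms by (simp add: centered_gaussian_def)
  consider "AE \<omega> in M. X \<omega> = 0"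
    | \<sigma> where "\<sigma> > 0" "distributed M lborel X (\<lambda>x. ennreal (normal_density 0 \<sigma> x))"
    using assms by (auto simp: centered_gaussian_def)
  then show ?thesis
  proof cases
    case 1
    then have "AE \<omega> in M. (X \<omega>)\<^sup>2 = 0" by eventually_elim simp
    then show ?thesis
      using integrable_cong_AE[of "\<lambda>\<omega>. (X \<omega>)\<^sup>2" M "\<lambda>_. 0"] by simp
  next
    case 2
    then show ?thesis
      using distributed_integrable[OF 2(2), of "\<lambda>x. x\<^sup>2"] integrable_normal_moment[of \<sigma> 0 2]
      by simp
  qed
qed

text \<open>
  An exhaustion of the lattice by an increasing sequence of finite sets, with respect to an arbitrary
  enumeration.  It turns unordered sums into limits of sequences, which preserve measurability.
\<close>

definition initial_frequencies :: "nat \<Rightarrow> (int^'d::finite) set" where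
  "initial_frequencies n = {k. to_nat k < n}"

lemma finite_initial_frequencies: "finite (initial_frequencies n)"
  unfolding initial_frequencies_def
  by (rule finite_imageD[of to_nat]) (auto intro: finite_subset[of _ "{..<n}"] inj_on_subset[OF inj_to_nat])

lemma finite_subset_initial_frequencies:
  assumes "finite F"
  obtains n where "F \<subseteq> initial_frequencies n"
proof
  show "F \<subseteq> initial_frequencies (Suc (Max (to_nat ` F)))"
    using assms by (auto simp: initial_frequencies_def le_imp_less_Suc)
qed

lemma initial_frequencies_mono: "m \<le> n \<Longrightarrow> initial_frequencies m \<subseteq> initial_frequencies n"
  by (auto simp: initial_frequencies_def)

lemma sum_initial_frequencies_tendsto_infsum:
  fixes f :: "int^'d::finite \<Rightarrow> real"
  assumes "f summable_on UNIV"
  shows "(\<lambda>n. \<Sum>k\<in>initial_frequencies n. f k) \<longlonglongrightarrow> infsum f UNIV"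
proof -
  have "filterlim (initial_frequencies :: nat \<Rightarrow> (int^'d) set) (finite_subsets_at_top UNIV) sequentially"
    unfolding filterlim_finite_subsets_at_top
  proof (intro allI impI)
    fix X :: "(int^'d) set" assume "finite X \<and> X \<subseteq> UNIV"
    then obtain m where m: "X \<subseteq> initial_frequencies m" using finite_subset_initial_frequencies by blast
    show "\<forall>\<^sub>F n in sequentially. finite (initial_frequencies n :: (int^'d) set) \<and> X \<subseteq> initial_frequencies n \<and> initial_frequencies n \<subseteq> (UNIV :: (int^'d) set)"
      using eventually_ge_at_top[of m]
      by eventually_elim (use m initial_frequencies_mono finite_initial_frequencies in blast)
  qed
  then show ?thesis
    using has_sum_infsum[OF assms] unfolding has_sum_def by (rule filterlim_compose[rotated])
qed

lemma cmod_fourier_coeff_square: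
  "(cmod (fourier_coeff F k))\<^sup>2 = (F (cos_wave k))\<^sup>2 + (F (sin_wave k))\<^sup>2"
  by (simp add: fourier_coeff_def cmod_power2 cos_wave_def[abs_def] sin_wave_def[abs_def])

text \<open>
  Every Fourier coefficient of white noise has second moment 1, whence
  \<open>E |N|\<^sup>2 = \<Sum> (1 + |k|\<^sup>2)\<^sup>-\<^sup>t\<close> for the norm of \<open>H\<^sup>-\<^sup>t\<close>.
\<close>

lemma white_noise_sobolev_bound:
  fixes N :: "'w \<Rightarrow> 'd::finite functional"
  assumes N: "white_noise M N" and t: "t > real CARD('d) / 2"
  obtains S where "integrable M S" "\<And>\<omega>. 0 \<le> S \<omega>"
    "AE \<omega> in M. \<forall>F. finite F \<longrightarrow>
      (\<Sum>k\<in>F. (1 + (norm (freq k))\<^sup>2) powr (- t) * (cmod (fourier_coeff (N \<omega>) k))\<^sup>2) \<le> S \<omega>"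
proof -
  define w where "w k = (1 + (norm (freq k))\<^sup>2) powr (- t)" for k :: "int^'d"
  have w0: "w k \<ge> 0" for k by (simp add: w_def)
  have ws: "w summable_on UNIV" unfolding w_def by (rule summable_on_sobolev_weight[OF t])
  have sq: "integrable M (\<lambda>\<omega>. (N \<omega> \<phi>)\<^sup>2)" and cov: "(\<integral>\<omega>. (N \<omega> \<phi>)\<^sup>2 \<partial>M) = (\<integral>x. \<phi> x * \<phi> x \<partial>torus_measure)"
    if "\<phi> \<in> test_functions" for \<phi>
  proof -
    have "centered_gaussian M (\<lambda>\<omega>. N \<omega> \<phi>)" using N that by (simp add: white_noise_def)
    then show "integrable M (\<lambda>\<omega>. (N \<omega> \<phi>)\<^sup>2)" by (rule centered_gaussian_square_integrable)
    show "(\<integral>\<omega>. (N \<omega> \<phi>)\<^sup>2 \<partial>M) = (\<integral>x. \<phi> x * \<phi> x \<partial>torus_measure)"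
      using N that unfolding white_noise_def power2_eq_square by blast
  qed
  have int: "integrable M (\<lambda>\<omega>. (cmod (fourier_coeff (N \<omega>) k))\<^sup>2)" for k
    unfolding cmod_fourier_coeff_square by (intro Bochner_Integration.integrable_add sq wave_test_function)
  have one: "(\<integral>\<omega>. (cmod (fourier_coeff (N \<omega>) k))\<^sup>2 \<partial>M) = 1" for k
  proof -
    have "(\<integral>\<omega>. (cmod (fourier_coeff (N \<omega>) k))\<^sup>2 \<partial>M) = cos_L2 k \<bullet> cos_L2 k + sin_L2 k \<bullet> sin_L2 k"
      unfolding cmod_fourier_coeff_square
      by (simp add: sq cov wave_test_function cos_L2_def sin_L2_def inner_abs_L2 square_integrable_wave)
    then show ?thesis by (simp add: inner_wave_L2)
  qed
  define P where "P n \<omega> = (\<Sum>k\<in>initial_frequencies n. w k * (cmod (fourier_coeff (N \<omega>) k))\<^sup>2)" for n \<omega>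
  have P0: "0 \<le> P n \<omega>" for n \<omega> unfolding P_def using w0 by (intro sum_nonneg) auto
  have Pint: "integrable M (P n)" for n
    unfolding P_def[abs_def] using int by auto
  then have [measurable]: "P n \<in> borel_measurable M" for n by auto
  have inc: "incseq (\<lambda>n \<omega>. ennreal (P n \<omega>))"
    unfolding P_def using w0
    by (auto simp: incseq_def le_fun_def initial_frequencies_mono finite_initial_frequencies
        intro!: ennreal_leI sum_mono2 dest: initial_frequencies_mono[THEN subsetD])
  have Pn: "(\<integral>\<^sup>+\<omega>. ennreal (P n \<omega>) \<partial>M) \<le> ennreal (infsum w UNIV)" for n
  proof -
    have "(\<integral>\<^sup>+\<omega>. ennreal (P n \<omega>) \<partial>M) = ennreal (\<integral>\<omega>. P n \<omega> \<partial>M)"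
      using P0 Pint by (intro nn_integral_eq_integral) auto
    also have "(\<integral>\<omega>. P n \<omega> \<partial>M) = (\<Sum>k\<in>initial_frequencies n. w k)"
      unfolding P_def using int one by simp
    also have "\<dots> \<le> infsum w UNIV"
      by (rule finite_sum_le_infsum[OF ws finite_initial_frequencies]) (use w0 in auto)
    finally show ?thesis by (simp add: ennreal_leI)
  qed
  \<comment> \<open>Extended real values keep the supremum meaningful on the null set where the sum diverges.\<close>
  define S' where "S' \<omega> = (SUP n. ennreal (P n \<omega>))" for \<omega>
  have [measurable]: "S' \<in> borel_measurable M" unfolding S'_def[abs_def] by measurable
  have "(\<integral>\<^sup>+\<omega>. S' \<omega> \<partial>M) = (SUP n. \<integral>\<^sup>+\<omega>. ennreal (P n \<omega>) \<partial>M)"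
    unfolding S'_def by (rule nn_integral_monotone_convergence_SUP[OF inc]) auto
  also have "\<dots> \<le> ennreal (infsum w UNIV)" by (intro SUP_least Pn)
  also have "\<dots> < \<infinity>" by simp
  finally have S'fin: "(\<integral>\<^sup>+\<omega>. S' \<omega> \<partial>M) < \<infinity>" .
  define S where "S \<omega> = enn2real (S' \<omega>)" for \<omega>
  have AEfin: "AE \<omega> in M. S' \<omega> \<noteq> \<infinity>"
    using S'fin by (intro nn_integral_PInf_AE) auto
  have "integrable M S"
  proof (rule integrableI_nonneg)
    have "(\<integral>\<^sup>+\<omega>. ennreal (S \<omega>) \<partial>M) \<le> (\<integral>\<^sup>+\<omega>. S' \<omega> \<partial>M)"
      unfolding S_def by (intro nn_integral_mono) (simp add: ennreal_enn2real_if)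
    then show "(\<integral>\<^sup>+\<omega>. ennreal (S \<omega>) \<partial>M) < \<infinity>" using S'fin by (rule le_less_trans)
  qed (auto simp: S_def[abs_def])
  moreover have "AE \<omega> in M. \<forall>F. finite F \<longrightarrow> (\<Sum>k\<in>F. w k * (cmod (fourier_coeff (N \<omega>) k))\<^sup>2) \<le> S \<omega>"
    using AEfin
  proof (eventually_elim, intro allI impI)
    fix \<omega> and F :: "(int^'d) set" assume fin: "S' \<omega> \<noteq> \<infinity>" and F: "finite F"
    obtain n where n: "F \<subseteq> initial_frequencies n" using finite_subset_initial_frequencies[OF F] .
    have "(\<Sum>k\<in>F. w k * (cmod (fourier_coeff (N \<omega>) k))\<^sup>2) \<le> P n \<omega>"
      unfolding P_def using n w0 by (intro sum_mono2 finite_initial_frequencies) auto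
    also have "ennreal (P n \<omega>) \<le> S' \<omega>" unfolding S'_def by (rule SUP_upper) simp
    then have "P n \<omega> \<le> S \<omega>"
      unfolding S_def using fin P0 by (metis enn2real_ennreal enn2real_mono infinity_ennreal_def less_top)
    finally show "(\<Sum>k\<in>F. w k * (cmod (fourier_coeff (N \<omega>) k))\<^sup>2) \<le> S \<omega>" .
  qed
  ultimately show ?thesis
    by (intro that[of S]) (auto simp: S_def w_def)
qed

text \<open>
  The Cauchy--Schwarz inequality with the weights \<open>(1 + |k|\<^sup>2)\<^sup>\<plusminus>\<^sup>t\<close> split between the factors.
\<close>

lemma sobolev_pairing_bound:
  fixes G F :: "'d::finite functional"
  assumes G: "G \<in> sobolev t"
    and S: "\<And>A. finite A \<Longrightarrow>
      (\<Sum>k\<in>A. (1 + (norm (freq k))\<^sup>2) powr (- t) * (cmod (fourier_coeff F k))\<^sup>2) \<le> S"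
  shows "(\<lambda>k. Re (fourier_coeff G k * cnj (fourier_coeff F k))) summable_on UNIV"
    and "\<bar>sobolev_pairing G F\<bar> \<le> sobolev_norm t G * sqrt S"
proof -
  let ?f = "\<lambda>k. Re (fourier_coeff G k * cnj (fourier_coeff F k))"
  define p where "p k = (1 + (norm (freq k))\<^sup>2) powr t" for k :: "int^'d"
  have p: "p k > 0" for k by (simp add: p_def add_nonneg_eq_0_iff)
  have pinv: "(1 + (norm (freq k))\<^sup>2) powr (- t) = inverse (p k)" for k :: "int^'d"
    by (simp add: p_def powr_minus)
  have sG: "(\<lambda>k. p k * (cmod (fourier_coeff G k))\<^sup>2) summable_on UNIV"
    using G by (simp add: sobolev_def p_def)
  have nG: "sobolev_norm t G = sqrt (\<Sum>\<^sub>\<infinity>k. p k * (cmod (fourier_coeff G k))\<^sup>2)"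
    by (simp add: sobolev_norm_def p_def)
  have S0: "0 \<le> S" using S[of "{}"] by simp
  have bound: "(\<Sum>k\<in>A. \<bar>?f k\<bar>) \<le> sobolev_norm t G * sqrt S" if A: "finite A" for A
  proof -
    have "(\<Sum>k\<in>A. \<bar>?f k\<bar>) \<le> (\<Sum>k\<in>A. (sqrt (p k) * cmod (fourier_coeff G k)) * (inverse (sqrt (p k)) * cmod (fourier_coeff F k)))"
    proof (rule sum_mono)
      fix k
      have "\<bar>?f k\<bar> \<le> cmod (fourier_coeff G k) * cmod (fourier_coeff F k)"
        by (metis abs_Re_le_cmod complex_mod_cnj norm_mult)
      also have "\<dots> = (sqrt (p k) * cmod (fourier_coeff G k)) * (inverse (sqrt (p k)) * cmod (fourier_coeff F k))"
        using p[of k] by simp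
      finally show "\<bar>?f k\<bar> \<le> (sqrt (p k) * cmod (fourier_coeff G k)) * (inverse (sqrt (p k)) * cmod (fourier_coeff F k))" .
    qed
    also have "\<dots> \<le> sqrt ((\<Sum>k\<in>A. (sqrt (p k) * cmod (fourier_coeff G k))\<^sup>2) * (\<Sum>k\<in>A. (inverse (sqrt (p k)) * cmod (fourier_coeff F k))\<^sup>2))"
      by (rule real_le_rsqrt[OF Cauchy_Schwarz_ineq_sum])
    also have "\<dots> = sqrt ((\<Sum>k\<in>A. p k * (cmod (fourier_coeff G k))\<^sup>2) * (\<Sum>k\<in>A. inverse (p k) * (cmod (fourier_coeff F k))\<^sup>2))"
      using p by (simp add: power_mult_distrib power_inverse less_imp_le)
    also have "\<dots> \<le> sqrt ((\<Sum>\<^sub>\<infinity>k. p k * (cmod (fourier_coeff G k))\<^sup>2) * S)"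
    proof (intro real_sqrt_le_mono mult_mono)
      show "(\<Sum>k\<in>A. p k * (cmod (fourier_coeff G k))\<^sup>2) \<le> (\<Sum>\<^sub>\<infinity>k. p k * (cmod (fourier_coeff G k))\<^sup>2)"
        using p by (intro finite_sum_le_infsum[OF sG A]) (auto simp: less_imp_le)
      show "(\<Sum>k\<in>A. inverse (p k) * (cmod (fourier_coeff F k))\<^sup>2) \<le> S"
        using S[OF A] by (simp add: pinv)
      show "0 \<le> (\<Sum>\<^sub>\<infinity>k. p k * (cmod (fourier_coeff G k))\<^sup>2)"
        using p by (intro infsum_nonneg) (auto simp: less_imp_le)
      show "0 \<le> (\<Sum>k\<in>A. inverse (p k) * (cmod (fourier_coeff F k))\<^sup>2)"
        using p by (intro sum_nonneg) (auto simp: less_imp_le)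
    qed
    also have "\<dots> = sobolev_norm t G * sqrt S"
      by (simp add: nG real_sqrt_mult)
    finally show ?thesis .
  qed
  have abs: "(\<lambda>k. \<bar>?f k\<bar>) summable_on UNIV"
  proof (rule nonneg_bdd_above_summable_on)
    show "bdd_above (sum (\<lambda>k. \<bar>?f k\<bar>) ` {A. A \<subseteq> UNIV \<and> finite A})"
      by (rule bdd_aboveI2[OF bound]) simp
  qed simp
  then have "(\<lambda>k. norm (?f k)) summable_on UNIV" by (simp only: real_norm_def)
  then show sum: "?f summable_on UNIV" by (rule abs_summable_summable)
  have "norm (infsum ?f UNIV) \<le> infsum (\<lambda>k. \<bar>?f k\<bar>) UNIV"
    by (rule norm_infsum_le[OF has_sum_infsum[OF sum] has_sum_infsum[OF abs]]) simp
  also have "\<dots> \<le> sobolev_norm t G * sqrt S"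
    by (rule infsum_le_finite_sums[OF abs]) (rule bound)
  finally show "\<bar>sobolev_pairing G F\<bar> \<le> sobolev_norm t G * sqrt S"
    by (simp add: sobolev_pairing_def)
qed

text \<open>
  Almost surely the pairing is a limit of finite sums of measurable functions; on the exceptional
  null set completeness of the measure suffices.
\<close>

lemma borel_measurable_sobolev_pairing:
  fixes N :: "'w \<Rightarrow> 'd::finite functional"
  assumes "complete_measure M" and N: "white_noise M N"
    and sum: "AE \<omega> in M. (\<lambda>k. Re (fourier_coeff G k * cnj (fourier_coeff (N \<omega>) k))) summable_on UNIV"
  shows "(\<lambda>\<omega>. sobolev_pairing G (N \<omega>)) \<in> borel_measurable M"
proof (rule complete_measure.borel_measurable_of_AE_eq[OF assms(1)])
  let ?P = "\<lambda>n \<omega>. \<Sum>k\<in>initial_frequencies n. Re (fourier_coeff G k * cnj (fourier_coeff (N \<omega>) k))"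
  have [measurable]: "(\<lambda>\<omega>. N \<omega> \<phi>) \<in> borel_measurable M" if "\<phi> \<in> test_functions" for \<phi>
    using N that by (auto simp: white_noise_def centered_gaussian_def)
  have "(\<lambda>\<omega>. Re (fourier_coeff G k * cnj (fourier_coeff (N \<omega>) k))) \<in> borel_measurable M" for k
  proof -
    have "Re (fourier_coeff G k * cnj (fourier_coeff (N \<omega>) k))
        = Re (fourier_coeff G k) * N \<omega> (cos_wave k) - Im (fourier_coeff G k) * N \<omega> (sin_wave k)" for \<omega>
      by (simp add: fourier_coeff_def cos_wave_def[abs_def] sin_wave_def[abs_def])
    then show ?thesis
      by (simp only:) (intro borel_measurable_diff borel_measurable_times borel_measurable_const
          \<open>\<And>\<phi>. \<phi> \<in> test_functions \<Longrightarrow> (\<lambda>\<omega>. N \<omega> \<phi>) \<in> borel_measurable M\<close> wave_test_function)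
  qed
  then show "(\<lambda>\<omega>. lim (\<lambda>n. ?P n \<omega>)) \<in> borel_measurable M"
    by (intro borel_measurable_lim_metric borel_measurable_sum) auto
  show "AE \<omega> in M. sobolev_pairing G (N \<omega>) = lim (\<lambda>n. ?P n \<omega>)"
    using sum
    by eventually_elim (simp only: sobolev_pairing_def limI[OF sum_initial_frequencies_tendsto_infsum])
qed

lemma fourier_coeff_L2_dist_add:
  "fourier_coeff (L2_dist (u + v)) k = fourier_coeff (L2_dist u) k + fourier_coeff (L2_dist v) k"
  by (simp add: fourier_coeff_L2_dist inner_add_left complex_eq_iff)

lemma fourier_coeff_L2_dist_scaleR:
  "fourier_coeff (L2_dist (c *\<^sub>R u)) k = of_real c * fourier_coeff (L2_dist u) k"
  by (simp add: fourier_coeff_L2_dist complex_eq_iff)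

section \<open>The convergence rate\<close>

text \<open>Parseval's identity turns the data misfit into a quadratic functional on \<open>L\<^sup>2\<close>.\<close>

lemma tikhonov_functional_eq_quadratic:
  fixes N :: "'w \<Rightarrow> 'd::finite functional"
  assumes sum: "\<And>v. (\<lambda>k. Re (fourier_coeff (L2_dist (K v)) k * cnj (fourier_coeff (N \<omega>) k))) summable_on UNIV"
  shows "tikhonov_functional K (\<lambda>u. (norm u)\<^sup>2 / 2) a (noisy_data K u0 N \<delta> \<omega>)
    = quad_tikhonov K a (\<lambda>v. K v \<bullet> K u0 + \<delta> * sobolev_pairing (L2_dist (K v)) (N \<omega>))"
proof
  fix u
  have fc: "fourier_coeff (noisy_data K u0 N \<delta> \<omega>) k
      = fourier_coeff (L2_dist (K u0)) k + of_real \<delta> * fourier_coeff (N \<omega>) k" for k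
    by (simp add: fourier_coeff_def noisy_data_def complex_eq_iff)
  have "sobolev_pairing (L2_dist (K u)) (noisy_data K u0 N \<delta> \<omega>)
      = (\<Sum>\<^sub>\<infinity>k. fourier_term (K u) (K u0) k + \<delta> * Re (fourier_coeff (L2_dist (K u)) k * cnj (fourier_coeff (N \<omega>) k)))"
    unfolding sobolev_pairing_def fc Re_fourier_coeff_mult_cnj[symmetric]
    by (intro infsum_cong) (simp add: algebra_simps)
  also have "\<dots> = K u \<bullet> K u0 + \<delta> * sobolev_pairing (L2_dist (K u)) (N \<omega>)"
    unfolding sobolev_pairing_def infsum_add[OF fourier_term_summable summable_on_cmult_right[OF sum]]
    by (simp only: parseval infsum_cmult_right')
  finally show "tikhonov_functional K (\<lambda>u. (norm u)\<^sup>2 / 2) a (noisy_data K u0 N \<delta> \<omega>) u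
    = quad_tikhonov K a (\<lambda>v. K v \<bullet> K u0 + \<delta> * sobolev_pairing (L2_dist (K v)) (N \<omega>)) u"
    by (simp add: tikhonov_functional_def quad_tikhonov_def)
qed

lemma linear_sobolev_pairing:
  assumes K: "linear K"
    and sum: "\<And>v. (\<lambda>k. Re (fourier_coeff (L2_dist (K v)) k * cnj (fourier_coeff F k))) summable_on UNIV"
  shows "linear (\<lambda>v. sobolev_pairing (L2_dist (K v)) F)"
proof (rule linearI)
  fix u v and c :: real
  show "sobolev_pairing (L2_dist (K (u + v))) F = sobolev_pairing (L2_dist (K u)) F + sobolev_pairing (L2_dist (K v)) F"
    unfolding sobolev_pairing_def infsum_add[OF sum sum, symmetric]
    by (intro infsum_cong) (simp add: linear_add[OF K] fourier_coeff_L2_dist_add algebra_simps)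
  have "(\<Sum>\<^sub>\<infinity>k. Re (fourier_coeff (L2_dist (K (c *\<^sub>R u))) k * cnj (fourier_coeff F k)))
      = (\<Sum>\<^sub>\<infinity>k. c * Re (fourier_coeff (L2_dist (K u)) k * cnj (fourier_coeff F k)))"
    by (intro infsum_cong) (simp add: linear_scale[OF K] fourier_coeff_L2_dist_scaleR algebra_simps)
  then show "sobolev_pairing (L2_dist (K (c *\<^sub>R u))) F = c *\<^sub>R sobolev_pairing (L2_dist (K u)) F"
    unfolding sobolev_pairing_def by (simp add: infsum_cmult_right')
qed

theorem theorem4p2:
  fixes M :: "'w measure"
    and N :: "'w \<Rightarrow> 'd::finite functional"
    and K Kstar :: "'d L2 \<Rightarrow> 'd L2"
    and R :: "'d L2 \<Rightarrow> real"
    and t :: real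
    and u0 w0 \<mu>0 :: "'d L2"
    and U \<mu> :: "real \<Rightarrow> real \<Rightarrow> 'w \<Rightarrow> 'd L2"
    and \<alpha> :: "real \<Rightarrow> real"
  assumes "prob_space M" and "complete_measure M"
    and "white_noise M N"
    and "t > real CARD('d) / 2"
    and "bounded_linear_into_sobolev t K"
    and "hilbert_schmidt K"
    and "is_adjoint K Kstar"
    and "R = (\<lambda>u. (norm u)\<^sup>2 / 2)"
    and estimator: "\<And>a \<delta>. a > 0 \<Longrightarrow> \<delta> > 0 \<Longrightarrow>
      AE \<omega> in M. is_arg_min (tikhonov_functional K R a (noisy_data K u0 N \<delta> \<omega>)) (\<lambda>u. True) (U a \<delta> \<omega>)"
    and subgradient: "\<And>a \<delta>. a > 0 \<Longrightarrow> \<delta> > 0 \<Longrightarrow>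
      AE \<omega> in M. \<mu> a \<delta> \<omega> \<in> subdifferential R (U a \<delta> \<omega>)"
    and source_condition: "\<mu>0 \<in> subdifferential R u0" "\<mu>0 = Kstar w0"
    and parameter_choice: "\<And>\<delta>. \<delta> > 0 \<Longrightarrow> \<alpha> \<delta> > 0"
      "\<alpha> \<in> \<Theta>[at_right 0](\<lambda>\<delta>. \<delta> powr (2 / 3))"
  shows "(\<forall>\<delta>>0.
        integrable M (\<lambda>\<omega>. sym_bregman (\<mu> (\<alpha> \<delta>) \<delta> \<omega>) \<mu>0 (U (\<alpha> \<delta>) \<delta> \<omega>) u0) \<and>
        integrable M (\<lambda>\<omega>. (norm (U (\<alpha> \<delta>) \<delta> \<omega> - u0))\<^sup>2) \<and>
        bregman_risk M (\<mu> (\<alpha> \<delta>) \<delta>) \<mu>0 (U (\<alpha> \<delta>) \<delta>) u0 =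
          (\<integral>\<omega>. (norm (U (\<alpha> \<delta>) \<delta> \<omega> - u0))\<^sup>2 \<partial>M)) \<and>
    (\<lambda>\<delta>. bregman_risk M (\<mu> (\<alpha> \<delta>) \<delta>) \<mu>0 (U (\<alpha> \<delta>) \<delta>) u0)
      \<in> O[at_right 0](\<lambda>\<delta>. \<delta> powr (2 / 3))"
proof -
  note M = assms(1) and complete = assms(2) and N = assms(3) and t = assms(4)
    and sob = assms(5) and HS = assms(6) and adj = assms(7) and R = assms(8)
  interpret prob_space M by (rule M)
  have K: "linear K" using sob by (simp add: bounded_linear_into_sobolev_def)
  have bK: "bounded_linear K" using HS by (simp add: hilbert_schmidt_def)
  obtain C where C: "\<And>u. L2_dist (K u) \<in> sobolev t" "\<And>u. sobolev_norm t (L2_dist (K u)) \<le> C * norm u"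
    using sob by (auto simp: bounded_linear_into_sobolev_def)
  obtain S where S: "integrable M S" "\<And>\<omega>. 0 \<le> S \<omega>"
    and AE_S: "AE \<omega> in M. \<forall>F. finite F \<longrightarrow>
      (\<Sum>k\<in>F. (1 + (norm (freq k))\<^sup>2) powr (- t) * (cmod (fourier_coeff (N \<omega>) k))\<^sup>2) \<le> S \<omega>"
    using white_noise_sobolev_bound[OF N t] by blast
  have \<mu>0: "\<mu>0 = u0" using source_condition(1) unfolding R by (rule subdifferential_half_norm_square)
  have source: "v \<bullet> u0 = K v \<bullet> w0" for v
    using adj source_condition(2) unfolding is_adjoint_def \<mu>0 by simp
  define l where "l \<delta> \<omega> v = \<delta> * sobolev_pairing (L2_dist (K v)) (N \<omega>)" for \<delta> \<omega> v
  define L where "L \<delta> \<omega> v = K v \<bullet> K u0 + l \<delta> \<omega> v" for \<delta> \<omega> v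
  \<comment> \<open>The realisations for which the noise pairs with the range of K as an element of the dual of H^t.\<close>
  define good where "good \<omega> \<longleftrightarrow> (\<forall>v. (\<lambda>k. Re (fourier_coeff (L2_dist (K v)) k * cnj (fourier_coeff (N \<omega>) k))) summable_on UNIV)
    \<and> (\<forall>v. \<bar>sobolev_pairing (L2_dist (K v)) (N \<omega>)\<bar> \<le> C * sqrt (S \<omega>) * norm v)" for \<omega>
  have AE_good: "AE \<omega> in M. good \<omega>"
    using AE_S
  proof eventually_elim
    case (elim \<omega>)
    then have le: "finite A \<Longrightarrow> (\<Sum>k\<in>A. (1 + (norm (freq k))\<^sup>2) powr (- t) * (cmod (fourier_coeff (N \<omega>) k))\<^sup>2) \<le> S \<omega>" for A
      by blast
    have "\<bar>sobolev_pairing (L2_dist (K v)) (N \<omega>)\<bar> \<le> C * sqrt (S \<omega>) * norm v" for v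
    proof -
      have "\<bar>sobolev_pairing (L2_dist (K v)) (N \<omega>)\<bar> \<le> sobolev_norm t (L2_dist (K v)) * sqrt (S \<omega>)"
        by (rule sobolev_pairing_bound(2)[OF C(1) le])
      also have "\<dots> \<le> (C * norm v) * sqrt (S \<omega>)"
        using S(2) by (intro mult_right_mono C(2)) auto
      finally show ?thesis by (simp add: ac_simps)
    qed
    then show ?case
      unfolding good_def using sobolev_pairing_bound(1)[OF C(1) le] by blast
  qed
  have lin: "linear (l \<delta> \<omega>)" "linear (L \<delta> \<omega>)" "bounded_linear (L \<delta> \<omega>)"
    and l_bound: "\<bar>l \<delta> \<omega> v\<bar> \<le> (\<bar>\<delta>\<bar> * C * sqrt (S \<omega>)) * norm v"
    and tikhonov_eq: "tikhonov_functional K R a (noisy_data K u0 N \<delta> \<omega>) = quad_tikhonov K a (L \<delta> \<omega>)"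
    if good: "good \<omega>" for a \<delta> \<omega> v
  proof -
    have sum: "\<And>v. (\<lambda>k. Re (fourier_coeff (L2_dist (K v)) k * cnj (fourier_coeff (N \<omega>) k))) summable_on UNIV"
      using good by (simp only: good_def)
    show lin_l: "linear (l \<delta> \<omega>)"
      unfolding l_def[abs_def]
      using linear_compose_scale_right[OF linear_sobolev_pairing[OF K sum], of \<delta>] by simp
    show bd: "\<bar>l \<delta> \<omega> v\<bar> \<le> (\<bar>\<delta>\<bar> * C * sqrt (S \<omega>)) * norm v" for v
    proof -
      have "\<bar>sobolev_pairing (L2_dist (K v)) (N \<omega>)\<bar> \<le> C * sqrt (S \<omega>) * norm v"
        using good by (simp only: good_def)
      then have "\<bar>\<delta>\<bar> * \<bar>sobolev_pairing (L2_dist (K v)) (N \<omega>)\<bar> \<le> \<bar>\<delta>\<bar> * (C * sqrt (S \<omega>) * norm v)"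
        by (rule mult_left_mono) simp
      then show ?thesis by (simp add: l_def abs_mult mult.assoc)
    qed
    have "bounded_linear (l \<delta> \<omega>)"
      by (rule bounded_linear_intro[where K="\<bar>\<delta>\<bar> * C * sqrt (S \<omega>)"])
        (use lin_l bd in \<open>auto simp: linear_add linear_scale mult.commute\<close>)
    then show bL: "bounded_linear (L \<delta> \<omega>)"
      unfolding L_def[abs_def]
      by (intro bounded_linear_add bounded_linear_inner_left_comp bK)
    then show "linear (L \<delta> \<omega>)" by (rule bounded_linear.linear)
    show "tikhonov_functional K R a (noisy_data K u0 N \<delta> \<omega>) = quad_tikhonov K a (L \<delta> \<omega>)"
      unfolding R L_def[abs_def] l_def[abs_def] by (rule tikhonov_functional_eq_quadratic[where N=N and \<omega>=\<omega>, OF sum])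
  qed
  \<comment> \<open>The variance term plus the bias term.\<close>
  define B where "B a \<delta> = \<delta>\<^sup>2 / a\<^sup>2 * (C\<^sup>2 * expectation S) + a * (norm w0)\<^sup>2 / 2" for a \<delta>
  have risk: "integrable M (\<lambda>\<omega>. (norm (U a \<delta> \<omega> - u0))\<^sup>2)"
    "expectation (\<lambda>\<omega>. (norm (U a \<delta> \<omega> - u0))\<^sup>2) \<le> B a \<delta>"
    if a: "a > 0" and \<delta>: "\<delta> > 0" for a \<delta>
  proof -
    let ?J = "\<lambda>\<omega>. tikhonov_functional K R a (noisy_data K u0 N \<delta> \<omega>)"
    have AE_min: "AE \<omega> in M. good \<omega> \<and> (\<forall>v. quad_tikhonov K a (L \<delta> \<omega>) (U a \<delta> \<omega>) \<le> quad_tikhonov K a (L \<delta> \<omega>) v)"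
      using AE_good estimator[OF a \<delta>]
      by eventually_elim (auto simp: tikhonov_eq is_arg_min_linorder)
    have "(\<lambda>\<omega>. (norm (U a \<delta> \<omega> - u0))\<^sup>2) \<in> borel_measurable M"
    proof (rule complete_measure.borel_measurable_at_minimiser[OF complete L2_separable, where c="a / 2" and J="?J"
          and g="\<lambda>u. (norm (u - u0))\<^sup>2" and U="U a \<delta>"])
      fix i :: "(rat \<times> bool \<times> (int^'d)) list"
      let ?z = "rational_combination trig_L2 i"
      have [measurable]: "(\<lambda>\<omega>. sobolev_pairing (L2_dist (K ?z)) (N \<omega>)) \<in> borel_measurable M"
        by (rule borel_measurable_sobolev_pairing[OF complete N])
          (use AE_good in \<open>eventually_elim, simp only: good_def\<close>)
      show "(\<lambda>\<omega>. ?J \<omega> ?z) \<in> borel_measurable M"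
      proof (rule complete_measure.borel_measurable_of_AE_eq[OF complete])
        show "(\<lambda>\<omega>. quad_tikhonov K a (L \<delta> \<omega>) ?z) \<in> borel_measurable M"
          unfolding quad_tikhonov_def L_def l_def by measurable
        show "AE \<omega> in M. ?J \<omega> ?z = quad_tikhonov K a (L \<delta> \<omega>) ?z"
          using AE_good by eventually_elim (simp add: tikhonov_eq)
      qed
    next
      show "AE \<omega> in M. continuous_on UNIV (?J \<omega>) \<and>
        (\<forall>v. ?J \<omega> (U a \<delta> \<omega>) + a / 2 * (dist v (U a \<delta> \<omega>))\<^sup>2 \<le> ?J \<omega> v)"
        using AE_min
      proof eventually_elim
        case (elim \<omega>)
        then have good: "good \<omega>" and min: "\<And>v. quad_tikhonov K a (L \<delta> \<omega>) (U a \<delta> \<omega>) \<le> quad_tikhonov K a (L \<delta> \<omega>) v" by auto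
        show ?case
          unfolding tikhonov_eq[OF good]
          using quad_tikhonov_continuous[OF bK lin(3)[OF good]] quad_tikhonov_quadratic_growth[OF K lin(2)[OF good] min] by blast
      qed
    qed (use a in \<open>auto intro!: continuous_intros\<close>)
    moreover have AE_bound: "AE \<omega> in M. (norm (U a \<delta> \<omega> - u0))\<^sup>2 \<le> \<delta>\<^sup>2 / a\<^sup>2 * (C\<^sup>2 * S \<omega>) + a * (norm w0)\<^sup>2 / 2"
      using AE_min
    proof eventually_elim
      case (elim \<omega>)
      then have good: "good \<omega>" and min: "\<And>v. quad_tikhonov K a (L \<delta> \<omega>) (U a \<delta> \<omega>) \<le> quad_tikhonov K a (L \<delta> \<omega>) v" by auto
      have "(norm (U a \<delta> \<omega> - u0))\<^sup>2 \<le> (\<bar>\<delta>\<bar> * C * sqrt (S \<omega>))\<^sup>2 / a\<^sup>2 + a * (norm w0)\<^sup>2 / 2"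
        by (rule quad_tikhonov_error_bound[OF K lin(1)[OF good] a min[unfolded L_def[abs_def]] l_bound[OF good] source])
      also have "(\<bar>\<delta>\<bar> * C * sqrt (S \<omega>))\<^sup>2 / a\<^sup>2 = \<delta>\<^sup>2 / a\<^sup>2 * (C\<^sup>2 * S \<omega>)"
        using S(2)[of \<omega>] by (simp add: power_mult_distrib)
      finally show ?case .
    qed
    moreover have int: "integrable M (\<lambda>\<omega>. \<delta>\<^sup>2 / a\<^sup>2 * (C\<^sup>2 * S \<omega>) + a * (norm w0)\<^sup>2 / 2)"
      using S(1) by simp
    ultimately show *: "integrable M (\<lambda>\<omega>. (norm (U a \<delta> \<omega> - u0))\<^sup>2)"
      by (intro Bochner_Integration.integrable_bound[OF int]) (auto elim!: eventually_mono)
    have "expectation (\<lambda>\<omega>. (norm (U a \<delta> \<omega> - u0))\<^sup>2)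
        \<le> expectation (\<lambda>\<omega>. \<delta>\<^sup>2 / a\<^sup>2 * (C\<^sup>2 * S \<omega>) + a * (norm w0)\<^sup>2 / 2)"
      by (rule integral_mono_AE[OF * int AE_bound])
    also have "\<dots> = B a \<delta>"
      using S(1) by (simp add: B_def prob_space)
    finally show "expectation (\<lambda>\<omega>. (norm (U a \<delta> \<omega> - u0))\<^sup>2) \<le> B a \<delta>" .
  qed
  have bregman: "AE \<omega> in M. sym_bregman (\<mu> a \<delta> \<omega>) \<mu>0 (U a \<delta> \<omega>) u0 = (norm (U a \<delta> \<omega> - u0))\<^sup>2"
    if "a > 0" "\<delta> > 0" for a \<delta>
    using subgradient[OF that]
  proof eventually_elim
    case (elim \<omega>)
    then have "\<mu> a \<delta> \<omega> = U a \<delta> \<omega>" unfolding R by (rule subdifferential_half_norm_square)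
    then show ?case by (simp add: \<mu>0 sym_bregman_def power2_norm_eq_inner)
  qed
  have first: "integrable M (\<lambda>\<omega>. sym_bregman (\<mu> a \<delta> \<omega>) \<mu>0 (U a \<delta> \<omega>) u0)"
    "bregman_risk M (\<mu> a \<delta>) \<mu>0 (U a \<delta>) u0 = (\<integral>\<omega>. (norm (U a \<delta> \<omega> - u0))\<^sup>2 \<partial>M)"
    if pos: "a > 0" "\<delta> > 0" for a \<delta>
  proof -
    have meas: "(\<lambda>\<omega>. (norm (U a \<delta> \<omega> - u0))\<^sup>2) \<in> borel_measurable M" using risk(1)[OF pos] by auto
    have meas': "(\<lambda>\<omega>. sym_bregman (\<mu> a \<delta> \<omega>) \<mu>0 (U a \<delta> \<omega>) u0) \<in> borel_measurable M"
      by (rule complete_measure.borel_measurable_of_AE_eq[OF complete meas bregman[OF pos]])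
    show "integrable M (\<lambda>\<omega>. sym_bregman (\<mu> a \<delta> \<omega>) \<mu>0 (U a \<delta> \<omega>) u0)"
      using integrable_cong_AE[OF meas' meas bregman[OF pos]] risk(1)[OF pos] by simp
    show "bregman_risk M (\<mu> a \<delta>) \<mu>0 (U a \<delta>) u0 = (\<integral>\<omega>. (norm (U a \<delta> \<omega> - u0))\<^sup>2 \<partial>M)"
      unfolding bregman_risk_def by (rule integral_cong_AE[OF meas' meas bregman[OF pos]])
  qed
  obtain c1 where c1: "c1 > 0" "\<forall>\<^sub>F \<delta> in at_right 0. norm (\<alpha> \<delta>) \<le> c1 * norm (\<delta> powr (2 / 3))"
    using bigthetaD1[OF parameter_choice(2)] by (elim landau_o.bigE)
  obtain c2 where c2: "c2 > 0" "\<forall>\<^sub>F \<delta> in at_right 0. norm (\<alpha> \<delta>) \<ge> c2 * norm (\<delta> powr (2 / 3))"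
    using bigthetaD2[OF parameter_choice(2)] by (elim landau_omega.bigE)
  have ES: "0 \<le> expectation S" using S(2) by (rule Bochner_Integration.integral_nonneg)
  have rate: "(\<lambda>\<delta>. bregman_risk M (\<mu> (\<alpha> \<delta>) \<delta>) \<mu>0 (U (\<alpha> \<delta>) \<delta>) u0) \<in> O[at_right 0](\<lambda>\<delta>. \<delta> powr (2 / 3))"
  proof (rule bigoI[where c="C\<^sup>2 * expectation S / c2\<^sup>2 + c1 * (norm w0)\<^sup>2 / 2"])
    show "\<forall>\<^sub>F \<delta> in at_right 0. norm (bregman_risk M (\<mu> (\<alpha> \<delta>) \<delta>) \<mu>0 (U (\<alpha> \<delta>) \<delta>) u0)
        \<le> (C\<^sup>2 * expectation S / c2\<^sup>2 + c1 * (norm w0)\<^sup>2 / 2) * norm (\<delta> powr (2 / 3))"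
      using c1(2) c2(2) eventually_at_right_less[of "0::real"]
    proof eventually_elim
      case (elim \<delta>)
      let ?p = "\<delta> powr (2 / 3)"
      have \<alpha>: "\<alpha> \<delta> > 0" using elim parameter_choice(1) by blast
      have p: "?p > 0" using elim by simp
      have up: "\<alpha> \<delta> \<le> c1 * ?p" and low: "c2 * ?p \<le> \<alpha> \<delta>" using elim \<alpha> by auto
      have "\<delta>\<^sup>2 / (\<alpha> \<delta>)\<^sup>2 \<le> \<delta>\<^sup>2 / (c2 * ?p)\<^sup>2"
        using low c2(1) p \<alpha> by (intro divide_left_mono power_mono mult_pos_pos zero_less_power) auto
      also have "\<dots> = ?p / c2\<^sup>2"
      proof -
        \<comment> \<open>The exponent 2/3 balances the two terms: \<delta>^2 / \<alpha>^2 is of the order of \<alpha> exactly if \<alpha>^3 is of the order of \<delta>^2.\<close>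
        have "\<delta>\<^sup>2 = ?p ^ 3" using elim by (simp add: powr_power)
        then show ?thesis using p c2(1) by (simp add: power_mult_distrib power2_eq_square power3_eq_cube)
      qed
      finally have q: "\<delta>\<^sup>2 / (\<alpha> \<delta>)\<^sup>2 \<le> ?p / c2\<^sup>2" .
      have "B (\<alpha> \<delta>) \<delta> \<le> ?p / c2\<^sup>2 * (C\<^sup>2 * expectation S) + c1 * ?p * (norm w0)\<^sup>2 / 2"
        unfolding B_def using ES
        by (intro add_mono mult_right_mono divide_right_mono q up) auto
      also have "\<dots> = (C\<^sup>2 * expectation S / c2\<^sup>2 + c1 * (norm w0)\<^sup>2 / 2) * ?p"
        by (simp add: field_simps)
      finally have "bregman_risk M (\<mu> (\<alpha> \<delta>) \<delta>) \<mu>0 (U (\<alpha> \<delta>) \<delta>) u0 \<le> (C\<^sup>2 * expectation S / c2\<^sup>2 + c1 * (norm w0)\<^sup>2 / 2) * ?p"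
        using risk(2)[OF \<alpha>, of \<delta>] first(2)[OF \<alpha>, of \<delta>] elim by linarith
      moreover have "0 \<le> bregman_risk M (\<mu> (\<alpha> \<delta>) \<delta>) \<mu>0 (U (\<alpha> \<delta>) \<delta>) u0"
        using first(2)[OF \<alpha>, of \<delta>] elim by simp
      ultimately show ?case using p by simp
    qed
  qed
  show ?thesis
    by (intro conjI allI impI rate first risk(1) parameter_choice(1))
qed

end
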